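(* Let $m\in\mathbb{N}$ and let $q$ be a prime power with $(m,q)\neq(1,2)$. Then $\textsc{PolSat}(\mathrm{Hol}(q,m))$ can be reduced in polynomial time to the complement of the restricted polynomial equivalence problem over $\mathrm{Mat}_m(\mathbb{F}_q)$.
   Context: $\mathrm{Hol}(q,m)$ is the group of pairs $(a,B)$ with $a\in\mathbb{F}_q^m$, $B\in\mathrm{GL}_m(\mathbb{F}_q)$, and multiplication $(v,A)\cdot(w,B)=(v+Aw,AB)$. $\textsc{PolSat}(G)$: given a word $w\in(G\cup X)^*$ ($X$ a set of variables), decide whether some assignment $X\to G$ makes $w$ (read as a product in $G$) evaluate to $1$. A restricted polynomial expression over $\mathrm{Mat}_m(\mathbb{F}_q)$ is a finite, possibly empty, formal sum of nonempty words over the alphabet of noncommuting variables $x_1,\dots,x_n$ together with elements of $\mathrm{GL}_m(\mathbb{F}_q)$, evaluated in the matrix ring in the obvious way. The restricted polynomial equivalence problem over $\mathrm{Mat}_m(\mathbb{F}_q)$ asks, given such an expression $p$, whether $p(\mathbf{x})=0$ for all $\mathbf{x}\in\mathrm{GL}_m(\mathbb{F}_q)^n$; its complement asks whether $p(\mathbf{x})\ne0$ for some $\mathbf{x}\in\mathrm{GL}_m(\mathbb{F}_q)^n$. A polynomial-time reduction of $A$ to $B$ is a polynomial-time transformation $P$ of inputs with $A(e)\iff B(P(e))$. *)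

theory Defs
  imports "HOL-Analysis.Analysis" "HOL-Algebra.Group"
begin

section \<open>Turing machines and polynomial-time reductions\<close>

text \<open>
  Deterministic multi-tape Turing machines with two-way infinite tapes; \<open>None\<close> is the blank.
  A machine is a list of commands, its states being the positions in that list and the position
  just past its end. State \<open>0\<close> is the initial state and \<open>length M\<close> the halting state. A command
  maps the list of scanned symbols to the successor state and one action (symbol to write, head
  movement) per tape. Over a finite alphabet this is a finite transition table.

  The input is on tape \<open>0\<close>, starting at the cell under the head; the output is on tape \<open>1\<close>,
  starting at cell \<open>0\<close>, with the rest of that tape blank.
\<close>

datatype move = MLeft | MStay | MRight

type_synonym 'a tape = "(int \<Rightarrow> 'a option) \<times> int"
type_synonym 'a command = "'a option list \<Rightarrow> nat \<times> ('a option \<times> move) list"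
type_synonym 'a machine = "'a command list"
type_synonym 'a config = "nat \<times> 'a tape list"

definition turing_machine :: "nat \<Rightarrow> 'a machine \<Rightarrow> bool" where
  "turing_machine k M \<longleftrightarrow> k \<ge> 2 \<and>
     (\<forall>cmd\<in>set M. \<forall>rs. length rs = k \<longrightarrow>
        fst (cmd rs) \<le> length M \<and> length (snd (cmd rs)) = k)"

fun scan :: "'a tape \<Rightarrow> 'a option" where
  "scan (c, h) = c h"

fun act :: "'a tape \<Rightarrow> 'a option \<times> move \<Rightarrow> 'a tape" where
  "act (c, h) (s, d) =
     (c(h := s), h + (case d of MLeft \<Rightarrow> -1 | MStay \<Rightarrow> 0 | MRight \<Rightarrow> 1))"

fun tm_step :: "'a machine \<Rightarrow> 'a config \<Rightarrow> 'a config" where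
  "tm_step M (s, ts) =
     (if s < length M
      then let (s', as) = (M ! s) (map scan ts) in (s', map2 act ts as)
      else (s, ts))"

definition tape_content :: "'a list \<Rightarrow> int \<Rightarrow> 'a option" where
  "tape_content w = (\<lambda>i. if 0 \<le> i \<and> i < int (length w) then Some (w ! nat i) else None)"

definition start_config :: "nat \<Rightarrow> 'a list \<Rightarrow> 'a config" where
  "start_config k w = (0, (tape_content w, 0) # replicate (k - 1) (\<lambda>_. None, 0))"

definition tm_computes_within :: "nat \<Rightarrow> 'a machine \<Rightarrow> 'a list \<Rightarrow> 'a list \<Rightarrow> nat \<Rightarrow> bool" where
  "tm_computes_within k M w u T \<longleftrightarrow>
     (\<exists>t\<le>T. \<exists>ts. (tm_step M ^^ t) (start_config k w) = (length M, ts) \<and>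
        fst (ts ! 1) = tape_content u)"

text \<open>
  The tape alphabet is the disjoint union of the (finite) alphabets of the input and of the output
  encoding. Time is measured in the length of the encoded input.
\<close>

definition poly_time_computable ::
  "('i \<Rightarrow> 'a::finite list) \<Rightarrow> ('j \<Rightarrow> 'b::finite list) \<Rightarrow> 'i set \<Rightarrow> ('i \<Rightarrow> 'j) \<Rightarrow> bool" where
  "poly_time_computable encI encO D f \<longleftrightarrow>
     (\<exists>k (M :: ('a + 'b) machine) c d. turing_machine k M \<and>
        (\<forall>e\<in>D. tm_computes_within k M (map Inl (encI e)) (map Inr (encO (f e)))
                  (c * length (encI e) ^ d + c)))"

record ('i, 'a) problem =
  inputs :: "'i set"
  accepts :: "'i \<Rightarrow> bool"
  encoding :: "'i \<Rightarrow> 'a list"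

definition complement :: "('i, 'a) problem \<Rightarrow> ('i, 'a) problem" where
  "complement A = A\<lparr>accepts := (\<lambda>e. \<not> accepts A e)\<rparr>"

definition poly_time_reducible ::
  "('i, 'a::finite) problem \<Rightarrow> ('j, 'b::finite) problem \<Rightarrow> bool" where
  "poly_time_reducible A B \<longleftrightarrow>
     (\<exists>P \<in> inputs A \<rightarrow> inputs B.
        poly_time_computable (encoding A) (encoding B) (inputs A) P \<and>
        (\<forall>e\<in>inputs A. accepts A e \<longleftrightarrow> accepts B (P e)))"


section \<open>Words with constants and variables, and their encoding\<close>

datatype 'c letter = Const 'c | Var nat

primrec letter_value :: "(nat \<Rightarrow> 'c) \<Rightarrow> 'c letter \<Rightarrow> 'c" where
  "letter_value \<sigma> (Const c) = c"
| "letter_value \<sigma> (Var i) = \<sigma> i"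

definition word_value ::
  "('c \<Rightarrow> 'c \<Rightarrow> 'c) \<Rightarrow> 'c \<Rightarrow> (nat \<Rightarrow> 'c) \<Rightarrow> 'c letter list \<Rightarrow> 'c" where
  "word_value mul e \<sigma> w = foldr (\<lambda>l. mul (letter_value \<sigma> l)) w e"

definition words_over :: "'c set \<Rightarrow> 'c letter list set" where
  "words_over C = lists (Const ` C \<union> range Var)"

text \<open>
  A constant is a single symbol of the alphabet, as the structures are finite and not part of the
  input. The variable with index \<open>i\<close> is the symbol \<open>VarSym\<close> followed by the binary digits of \<open>i\<close>,
  least significant digit first. Each summand of a formal sum is terminated by \<open>EndSym\<close>.
\<close>

datatype 'c symbol = ConstSym 'c | VarSym | BitSym bool | EndSym

instance symbol :: (finite) finite
proof
  have "(UNIV :: 'a symbol set) \<subseteq> range ConstSym \<union> range BitSym \<union> {VarSym, EndSym}"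
  proof
    fix x :: "'a symbol"
    show "x \<in> range ConstSym \<union> range BitSym \<union> {VarSym, EndSym}"
      by (cases x) auto
  qed
  then show "finite (UNIV :: 'a symbol set)"
    by (rule finite_subset) simp
qed

fun binary :: "nat \<Rightarrow> bool list" where
  "binary n = (if n = 0 then [] else odd n # binary (n div 2))"

declare binary.simps [simp del]

primrec encode_letter :: "'c letter \<Rightarrow> 'c symbol list" where
  "encode_letter (Const c) = [ConstSym c]"
| "encode_letter (Var i) = VarSym # map BitSym (binary i)"

definition encode_word :: "'c letter list \<Rightarrow> 'c symbol list" where
  "encode_word w = concat (map encode_letter w)"

definition encode_sum :: "'c letter list list \<Rightarrow> 'c symbol list" where
  "encode_sum p = concat (map (\<lambda>w. encode_word w @ [EndSym]) p)"


section \<open>Satisfiability over groups and restricted polynomial equivalence\<close>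

definition PolSat :: "('g, 'x) monoid_scheme \<Rightarrow> ('g letter list, 'g symbol) problem" where
  "PolSat G = \<lparr>
     inputs = words_over (carrier G),
     accepts = (\<lambda>w. \<exists>\<sigma> \<in> UNIV \<rightarrow> carrier G.
        word_value (mult G) \<one>\<^bsub>G\<^esub> \<sigma> w = \<one>\<^bsub>G\<^esub>),
     encoding = encode_word\<rparr>"

definition Hol :: "((('q::{field,finite})^'m) \<times> ('q^'m^'m)) monoid" where
  "Hol = \<lparr>
     carrier = {(a, B). invertible B},
     mult = (\<lambda>(v, A) (w, B). (v + A *v w, A ** B)),
     one = (0, mat 1)\<rparr>"

definition GL :: "(('q::{field,finite})^'m^'m) set" where
  "GL = {A. invertible A}"

definition restricted_polynomials :: "(('q::{field,finite})^'m^'m) letter list list set" where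
  "restricted_polynomials = lists (words_over GL - {[]})"

definition polynomial_value ::
  "(nat \<Rightarrow> ('q::{field,finite})^'m^'m) \<Rightarrow> ('q^'m^'m) letter list list \<Rightarrow> 'q^'m^'m" where
  "polynomial_value \<sigma> p = (\<Sum>w\<leftarrow>p. word_value (**) (mat 1) \<sigma> w)"

definition RestrictedPolEquiv ::
  "((('q::{field,finite})^'m^'m) letter list list, ('q^'m^'m) symbol) problem" where
  "RestrictedPolEquiv = \<lparr>
     inputs = restricted_polynomials,
     accepts = (\<lambda>p. \<forall>\<sigma> \<in> UNIV \<rightarrow> GL. polynomial_value \<sigma> p = 0),
     encoding = encode_sum\<rparr>"

lemma group_Hol: "group (Hol :: ((('q::{field,finite})^'m) \<times> ('q^'m^'m)) monoid)"
proof (rule groupI)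
  fix x :: "('q^'m) \<times> ('q^'m^'m)"
  assume x: "x \<in> carrier Hol"
  obtain v A where xv: "x = (v, A)" by (cases x)
  obtain B where B: "A ** B = mat 1" "B ** A = mat 1"
    using x unfolding xv Hol_def invertible_def by auto
  have "(- (B *v v), B) \<in> carrier Hol"
    using B unfolding Hol_def invertible_def by auto
  moreover have "(- (B *v v), B) \<otimes>\<^bsub>Hol\<^esub> x = \<one>\<^bsub>Hol\<^esub>"
    using B by (simp add: Hol_def xv)
  ultimately show "\<exists>y\<in>carrier Hol. y \<otimes>\<^bsub>Hol\<^esub> x = \<one>\<^bsub>Hol\<^esub>"
    by blast
qed (auto simp: Hol_def invertible_mult matrix_vector_mul_assoc matrix_mul_assoc
       matrix_vector_right_distrib invertible_def[of "mat 1"] intro: exI[of _ "mat 1"])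

end

theory Submission
  imports Defs
begin

text \<open>
  Fix the unit vector \<open>e = axis k 1\<close>. Unless \<open>(m, q) = (1, 2)\<close>, every vector is a sum of two nonzero
  vectors, and every nonzero vector is \<open>U e\<close> for some invertible \<open>U\<close>. Hence every group element is
  \<open>(U e + U' e, A)\<close> with invertible \<open>U\<close>, \<open>U'\<close>, \<open>A\<close>. Evaluating a word over the group then yields
  \<open>(S e, Q)\<close>, where \<open>S\<close> is a sum of two words per letter and \<open>Q\<close> is a single word, all in units. Since the
  matrix units are sums of invertible matrices, some fixed polynomial in two matrices \<open>S\<close>, \<open>Q\<close> is
  nonzero exactly if \<open>S e = 0\<close> and \<open>Q = 1\<close>. Substituting \<open>S\<close> and \<open>Q\<close> into it and expanding gives the
  reduction; as the degree is fixed, the expansion has polynomial size, and a machine with one tape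
  for each letter of the fixed polynomial prints it by nested loops.
\<close>

section \<open>Building blocks for Turing machines\<close>

text \<open>The target problem has no vectors, and its variables take invertible values only. A
  vector is therefore coded by the action of units on \<open>e\<close>. One unit reaches every
  vector except 0, hence the sum of two; for \<open>(m, q) = (1, 2)\<close> the only unit is 1 and
  such a sum is always 0. The coding is not unique, but any \<open>U\<close>, \<open>U'\<close>,
  \<open>A\<close> in \<open>GL\<close> define a group element, so assignments can be carried over
  in both directions. Two obstacles shape the rest. \<open>S\<close> need not be invertible, so the
  fixed polynomial must be correct on all matrices although its coefficients are units. And
  polynomial time is shown for an explicit machine, so tape formats and variable indices are chosen
  such that it only copies and rewrites symbols, without arithmetic.\<close>

definition relocate :: "nat \<Rightarrow> 'a command \<Rightarrow> 'a command" where
  "relocate n cmd = (\<lambda>rs. (n + fst (cmd rs), snd (cmd rs)))"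

definition idle :: "'a option list \<Rightarrow> ('a option \<times> move) list" where
  "idle rs = map (\<lambda>s. (s, MStay)) rs"

text \<open>The halting state \<open>length M\<close> of the first machine is the position of the
  first command of the second, so no linking command is needed.\<close>

definition seq_machine :: "'a machine \<Rightarrow> 'a machine \<Rightarrow> 'a machine" (infixr \<open>\<then>\<close> 65) where
  "M \<then> N = M @ map (relocate (length M)) N"

text \<open>Command 0 tests, the body occupies positions 1 to \<open>length M\<close>, and the
  halting state of the body is the last command, which jumps back. An iteration costs two steps
  beyond the body.\<close>

definition while_machine :: "nat \<Rightarrow> ('a option \<Rightarrow> bool) \<Rightarrow> 'a machine \<Rightarrow> 'a machine" where
  "while_machine i b M =
     (\<lambda>rs. (if b (rs ! i) then 1 else length M + 2, idle rs)) #
     map (relocate 1) M @ [\<lambda>rs. (0, idle rs)]"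

definition step_machine ::
  "nat \<Rightarrow> nat \<Rightarrow> ('a option \<Rightarrow> 'a option \<Rightarrow> 'a option \<times> move) \<Rightarrow> 'a machine" where
  "step_machine i j g = [\<lambda>rs. (1, (idle rs)[j := g (rs ! i) (rs ! j)])]"

definition well_formed :: "'a machine \<Rightarrow> bool" where
  "well_formed M \<longleftrightarrow>
     (\<forall>cmd\<in>set M. \<forall>rs. fst (cmd rs) \<le> length M \<and> length (snd (cmd rs)) = length rs)"

lemma well_formed_intros [simp, intro]:
  "well_formed []"
  "well_formed (step_machine i j g)"
  "well_formed M \<Longrightarrow> well_formed N \<Longrightarrow> well_formed (M \<then> N)"
  "well_formed M \<Longrightarrow> well_formed (while_machine i b M)"
  unfolding well_formed_def step_machine_def seq_machine_def while_machine_def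
  by (auto simp: relocate_def idle_def trans_le_add1 le_SucI)

lemma turing_machineI: "k \<ge> 2 \<Longrightarrow> well_formed M \<Longrightarrow> turing_machine k M"
  unfolding well_formed_def turing_machine_def by auto

text \<open>Tapes are given by a function so that the effect of a machine is a function update;
  \<open>T\<close> is an upper bound, so estimates can be rounded up.\<close>

definition runs :: "nat \<Rightarrow> 'a machine \<Rightarrow> (nat \<Rightarrow> 'a tape) \<Rightarrow> (nat \<Rightarrow> 'a tape) \<Rightarrow> nat \<Rightarrow> bool" where
  "runs k M F F' T \<longleftrightarrow>
     (\<exists>t\<le>T. (tm_step M ^^ t) (0, map F [0..<k]) = (length M, map F' [0..<k]))"

lemma tm_step_halted: "length M \<le> s \<Longrightarrow> (tm_step M ^^ t) (s, ts) = (s, ts)"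
  by (induction t) auto

text \<open>The number of steps may drop: \<open>M\<close> rests once it has halted, whereas
  \<open>N\<close> would go on, so the run of \<open>N\<close> is cut at the first arrival in the
  halting state of \<open>M\<close>.\<close>

lemma tm_step_embed:
  assumes "\<And>s. s < length M \<Longrightarrow> n + s < length N \<and> N ! (n + s) = relocate n (M ! s)"
    and "(tm_step M ^^ t) (s, ts) = (length M, ts')"
  shows "\<exists>t'\<le>t. (tm_step N ^^ t') (n + s, ts) = (n + length M, ts')"
  using assms(2)
proof (induction t arbitrary: s ts)
  case 0
  then show ?case by auto
next
  case (Suc t)
  show ?case
  proof (cases "s < length M")
    case False
    then have "(s, ts) = (length M, ts')"
      using Suc.prems tm_step_halted[of M s "Suc t" ts] by simp
    then show ?thesis by (intro exI[of _ 0]) simp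
  next
    case True
    obtain s1 ts1 where 1: "tm_step M (s, ts) = (s1, ts1)"
      by (cases "tm_step M (s, ts)")
    have "tm_step N (n + s, ts) = (n + s1, ts1)"
      using 1 True assms(1)[OF True] by (auto simp: relocate_def split: prod.splits)
    moreover obtain t' where "t' \<le> t" "(tm_step N ^^ t') (n + s1, ts1) = (n + length M, ts')"
      using Suc.IH[of s1 ts1] Suc.prems 1 by (auto simp: funpow_Suc_right simp del: funpow.simps)
    ultimately show ?thesis
      by (intro exI[of _ "Suc t'"]) (simp add: funpow_Suc_right del: funpow.simps tm_step.simps)
  qed
qed

lemma act_idle: "map2 act ts (idle (map scan ts)) = ts"
proof (rule nth_equalityI)
  fix i assume "i < length (map2 act ts (idle (map scan ts)))"
  then show "map2 act ts (idle (map scan ts)) ! i = ts ! i"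
    by (cases "ts ! i") (auto simp: idle_def)
qed (simp add: idle_def)

lemma runs_Nil: "runs k [] F F T"
  unfolding runs_def by (auto intro: exI[of _ 0])

lemma runs_seq:
  assumes "runs k M F G T1" "runs k N G H T2" "T1 + T2 \<le> T"
  shows "runs k (M \<then> N) F H T"
proof -
  let ?R = "M \<then> N"
  obtain t1 where t1: "t1 \<le> T1" "(tm_step M ^^ t1) (0, map F [0..<k]) = (length M, map G [0..<k])"
    using assms unfolding runs_def by auto
  obtain t2 where t2: "t2 \<le> T2" "(tm_step N ^^ t2) (0, map G [0..<k]) = (length N, map H [0..<k])"
    using assms unfolding runs_def by auto
  have "\<exists>t'\<le>t1. (tm_step ?R ^^ t') (0 + 0, map F [0..<k]) = (0 + length M, map G [0..<k])"
    by (rule tm_step_embed[OF _ t1(2)]) (auto simp: seq_machine_def nth_append relocate_def)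
  then obtain u1 where u1: "u1 \<le> t1" "(tm_step ?R ^^ u1) (0, map F [0..<k]) = (length M, map G [0..<k])"
    by auto
  have "\<exists>t'\<le>t2. (tm_step ?R ^^ t') (length M + 0, map G [0..<k])
      = (length M + length N, map H [0..<k])"
    by (rule tm_step_embed[OF _ t2(2)]) (auto simp: seq_machine_def nth_append)
  then obtain u2 where u2: "u2 \<le> t2"
    "(tm_step ?R ^^ u2) (length M, map G [0..<k]) = (length M + length N, map H [0..<k])"
    by auto
  have "(tm_step ?R ^^ (u2 + u1)) (0, map F [0..<k]) = (length ?R, map H [0..<k])"
    using u1 u2 by (simp add: funpow_add seq_machine_def)
  then show ?thesis
    unfolding runs_def using u1 u2 t1 t2 assms(3) by (intro exI[of _ "u2 + u1"]) auto
qed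

lemma runs_while_False:
  assumes "i < k" "\<not> b (scan (F i))"
  shows "runs k (while_machine i b M) F F (Suc T)"
  unfolding runs_def
  by (rule exI[of _ "Suc 0"])
    (use assms act_idle[of "map F [0..<k]"] in \<open>auto simp: while_machine_def\<close>)

lemma runs_while_True:
  assumes "i < k" "b (scan (F i))" "runs k M F G T1" "runs k (while_machine i b M) G H T2"
    "T1 + T2 + 2 \<le> T"
  shows "runs k (while_machine i b M) F H T"
proof -
  let ?R = "while_machine i b M"
  obtain t1 where t1: "t1 \<le> T1" "(tm_step M ^^ t1) (0, map F [0..<k]) = (length M, map G [0..<k])"
    using assms unfolding runs_def by auto
  obtain t2 where t2: "t2 \<le> T2" "(tm_step ?R ^^ t2) (0, map G [0..<k]) = (length ?R, map H [0..<k])"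
    using assms unfolding runs_def by auto
  have "\<exists>t'\<le>t1. (tm_step ?R ^^ t') (1 + 0, map F [0..<k]) = (1 + length M, map G [0..<k])"
    by (rule tm_step_embed[OF _ t1(2)]) (auto simp: while_machine_def nth_append)
  then obtain u1 where u1: "u1 \<le> t1"
    "(tm_step ?R ^^ u1) (1, map F [0..<k]) = (Suc (length M), map G [0..<k])"
    by auto
  have a: "tm_step ?R (0, map F [0..<k]) = (1, map F [0..<k])"
    using assms act_idle[of "map F [0..<k]"] by (auto simp: while_machine_def)
  have b: "tm_step ?R (Suc (length M), map G [0..<k]) = (0, map G [0..<k])"
    using act_idle[of "map G [0..<k]"] by (auto simp: while_machine_def nth_append)
  have "(tm_step ?R ^^ (t2 + Suc (u1 + Suc 0))) (0, map F [0..<k]) = (length ?R, map H [0..<k])"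
    unfolding funpow_add funpow.simps o_apply id_apply a u1(2) b t2(2) ..
  then show ?thesis
    unfolding runs_def using u1 t1 t2 assms(5)
    by (intro exI[of _ "t2 + Suc (u1 + Suc 0)"]) auto
qed

lemma runs_step:
  assumes "i < k" "j < k"
  shows "runs k (step_machine i j g) F (F(j := act (F j) (g (scan (F i)) (scan (F j))))) (Suc T)"
proof -
  let ?ts = "map F [0..<k]" and ?a = "g (scan (F i)) (scan (F j))"
  have "map2 act ?ts ((idle (map scan ?ts))[j := ?a]) = map (F(j := act (F j) ?a)) [0..<k]"
  proof (rule nth_equalityI)
    fix l assume "l < length (map2 act ?ts ((idle (map scan ?ts))[j := ?a]))"
    then show "map2 act ?ts ((idle (map scan ?ts))[j := ?a]) ! l
        = map (F(j := act (F j) ?a)) [0..<k] ! l"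
      by (cases "F l"; cases "l = j") (auto simp: idle_def)
  qed (simp add: idle_def)
  then show ?thesis
    unfolding runs_def using assms
    by (intro exI[of _ "Suc 0"]) (auto simp: step_machine_def)
qed

section \<open>Tapes as zippers\<close>

text \<open>\<open>ls\<close> lists the cells left of the head in reverse order, so a head movement
  acts on two list heads. The content starts at cell 0 and has no gaps.\<close>

definition zipper :: "'a list \<Rightarrow> 'a list \<Rightarrow> 'a tape" where
  "zipper ls rs = (tape_content (rev ls @ rs), int (length ls))"

lemma scan_zipper [simp]: "scan (zipper ls rs) = (case rs of [] \<Rightarrow> None | x # _ \<Rightarrow> Some x)"
  by (auto simp: zipper_def tape_content_def nth_append split: list.splits)

lemma tape_content_write:
  "(tape_content (xs @ r))(int (length xs) := Some y) = tape_content (xs @ y # tl r)"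
  by (rule ext) (cases r; auto simp: tape_content_def nth_append nth_Cons' nat_less_iff)

lemma act_zipper_right: "act (zipper ls (x # rs)) (Some y, MRight) = zipper (y # ls) rs"
  using tape_content_write[of "rev ls" "x # rs" y] by (simp add: zipper_def)

lemma act_zipper_push: "act (zipper ls []) (Some y, MRight) = zipper (y # ls) []"
  using tape_content_write[of "rev ls" "[]" y] by (simp add: zipper_def)

lemma act_rewrite: "act (c, h) (c h, d) =
    (c, h + (case d of MLeft \<Rightarrow> -1 | MStay \<Rightarrow> 0 | MRight \<Rightarrow> 1))"
  by simp

lemma act_zipper_stay: "act (zipper ls rs) (scan (zipper ls rs), MStay) = zipper ls rs"
  by (simp add: zipper_def del: act.simps add: act_rewrite)

text \<open>A head moving left from cell 0 reaches the blank cell -1, a position that no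
  \<open>zipper\<close> describes; rewinding to the start of a tape passes through it.\<close>

fun left_of :: "'a list \<Rightarrow> 'a list \<Rightarrow> 'a tape" where
  "left_of [] rs = (tape_content rs, -1)"
| "left_of (x # ls) rs = zipper ls (x # rs)"

lemma scan_left_of [simp]: "scan (left_of ls rs) = (case ls of [] \<Rightarrow> None | x # _ \<Rightarrow> Some x)"
  by (cases ls) (auto simp: tape_content_def)

lemma act_zipper_left: "act (zipper ls rs) (scan (zipper ls rs), MLeft) = left_of ls rs"
  by (cases ls) (simp_all add: zipper_def del: act.simps add: act_rewrite)

lemma act_left_of: "act (left_of ls rs) (scan (left_of ls rs), MRight) = zipper ls rs"
  by (cases ls) (simp_all add: zipper_def del: act.simps add: act_rewrite)

declare scan.simps [simp del] act.simps [simp del]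

section \<open>Moving, writing, copying, rewinding and skipping on tapes\<close>

definition move_machine :: "nat \<Rightarrow> move \<Rightarrow> 'a machine" where
  "move_machine j d = step_machine j j (\<lambda>_ s. (s, d))"

definition put_machine :: "nat \<Rightarrow> 'a \<Rightarrow> 'a machine" where
  "put_machine j x = step_machine j j (\<lambda>_ _. (Some x, MRight))"

text \<open>A step writes one symbol per tape, so \<open>h x\<close> is written by successive
  commands; those beyond its length leave the tape as it is. The head on tape \<open>i\<close> stays
  put, so all of them see the same \<open>x\<close>.\<close>

primrec pushes_machine :: "nat \<Rightarrow> nat \<Rightarrow> ('a \<Rightarrow> 'a list) \<Rightarrow> nat \<Rightarrow> 'a machine" where
  "pushes_machine i j h 0 = []"
| "pushes_machine i j h (Suc n) = pushes_machine i j h n \<then>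
     step_machine i j (\<lambda>r s. case r of None \<Rightarrow> (s, MStay) | Some x \<Rightarrow>
       if n < length (h x) then (Some (h x ! n), MRight) else (s, MStay))"

text \<open>A blank fails every test, so even with a constantly true predicate a loop stops at the
  end of the content.\<close>

definition test :: "('a \<Rightarrow> bool) \<Rightarrow> 'a option \<Rightarrow> bool" where
  "test P r = (case r of None \<Rightarrow> False | Some x \<Rightarrow> P x)"

lemma test_simps [simp]: "test P None = False" "test P (Some x) = P x"
  by (simp_all add: test_def)

text \<open>Four is the length of the longest word that a symbol is rewritten to:
  \<open>VarSym\<close> with a prefix of three binary digits.\<close>

definition transfer_machine :: "nat \<Rightarrow> nat \<Rightarrow> ('a \<Rightarrow> 'a list) \<Rightarrow> 'a machine" where
  "transfer_machine i j h = pushes_machine i j h 4 \<then> move_machine i MRight"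

definition copy_machine :: "('a \<Rightarrow> bool) \<Rightarrow> nat \<Rightarrow> nat \<Rightarrow> ('a \<Rightarrow> 'a list) \<Rightarrow> 'a machine" where
  "copy_machine P i j h = while_machine i (test P) (transfer_machine i j h)"

definition rewind_machine :: "('a \<Rightarrow> bool) \<Rightarrow> nat \<Rightarrow> 'a machine" where
  "rewind_machine P i = move_machine i MLeft \<then>
     while_machine i (test P) (move_machine i MLeft) \<then> move_machine i MRight"

definition skip_machine :: "('a \<Rightarrow> bool) \<Rightarrow> nat \<Rightarrow> 'a machine" where
  "skip_machine P i = while_machine i (test P) (move_machine i MRight)"

lemma well_formed_machines [simp, intro]:
  "well_formed (move_machine j d)"
  "well_formed (put_machine j x)"
  "well_formed (pushes_machine i j h n)"
  "well_formed (transfer_machine i j h)"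
  "well_formed (copy_machine P i j h)"
  "well_formed (rewind_machine P i)"
  "well_formed (skip_machine P i)"
proof -
  show *: "well_formed (pushes_machine i j h n)" for n by (induction n) auto
  then show "well_formed (transfer_machine i j h)" "well_formed (copy_machine P i j h)"
    by (auto simp: transfer_machine_def move_machine_def copy_machine_def
      simp del: pushes_machine.simps)
qed (auto simp: move_machine_def put_machine_def rewind_machine_def skip_machine_def)

lemma runs_put:
  "j < k \<Longrightarrow> F j = zipper ls [] \<Longrightarrow> runs k (put_machine j x) F (F(j := zipper (x # ls) [])) 1"
  using runs_step[of j k j "\<lambda>_ _. (Some x, MRight)" F 0]
  by (simp add: put_machine_def act_zipper_push)

lemma runs_right:
  "j < k \<Longrightarrow> F j = zipper ls (x # rs) \<Longrightarrow>
   runs k (move_machine j MRight) F (F(j := zipper (x # ls) rs)) 1"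
  using runs_step[of j k j "\<lambda>_ s. (s, MRight)" F 0]
  by (simp add: move_machine_def act_zipper_right)

lemma runs_left:
  "j < k \<Longrightarrow> F j = zipper ls rs \<Longrightarrow>
   runs k (move_machine j MLeft) F (F(j := left_of ls rs)) 1"
  using runs_step[of j k j "\<lambda>_ s. (s, MLeft)" F 0] act_zipper_left[of ls rs]
  by (simp add: move_machine_def)

lemma runs_from_left_of:
  "j < k \<Longrightarrow> F j = left_of ls rs \<Longrightarrow>
   runs k (move_machine j MRight) F (F(j := zipper ls rs)) 1"
  using runs_step[of j k j "\<lambda>_ s. (s, MRight)" F 0] act_left_of[of ls rs]
  by (simp add: move_machine_def)

lemma runs_pushes:
  assumes "i < k" "j < k" "i \<noteq> j" "F i = zipper li (x # ri)" "F j = zipper lj []"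
  shows "runs k (pushes_machine i j h n) F (F(j := zipper (rev (take n (h x)) @ lj) [])) n"
proof (induction n)
  case 0
  then show ?case using runs_Nil[of k F 0] assms by (simp add: fun_upd_idem)
next
  case (Suc n)
  let ?g = "\<lambda>r s. case r of None \<Rightarrow> (s, MStay) | Some x \<Rightarrow>
       if n < length (h x) then (Some (h x ! n), MRight) else (s, MStay)"
  let ?F = "F(j := zipper (rev (take n (h x)) @ lj) [])"
  have "runs k (step_machine i j ?g) ?F
      (?F(j := act (?F j) (?g (scan (?F i)) (scan (?F j))))) 1"
    using runs_step[OF assms(1,2), of ?g ?F 0] by (simp only: One_nat_def)
  moreover have "act (?F j) (?g (scan (?F i)) (scan (?F j)))
      = zipper (rev (take (Suc n) (h x)) @ lj) []"
    using assms act_zipper_push[of "rev (take n (h x)) @ lj"]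
      act_zipper_stay[of "rev (take n (h x)) @ lj" "[]"]
    by (auto simp: take_Suc_conv_app_nth)
  ultimately have 2: "runs k (step_machine i j ?g) ?F
      (F(j := zipper (rev (take (Suc n) (h x)) @ lj) [])) 1"
    by (simp only: fun_upd_upd)
  show ?case
    unfolding pushes_machine.simps by (rule runs_seq[OF Suc 2]) simp
qed

lemma runs_transfer:
  assumes "i < k" "j < k" "i \<noteq> j" "F i = zipper li (x # ri)" "F j = zipper lj []"
    "length (h x) \<le> 4"
  shows "runs k (transfer_machine i j h) F
     (F(i := zipper (x # li) ri, j := zipper (rev (h x) @ lj) [])) 5"
proof -
  let ?F = "F(j := zipper (rev (h x) @ lj) [])"
  have "runs k (pushes_machine i j h 4) F ?F 4"
    using runs_pushes[OF assms(1-5), of h 4] assms(6) by simp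
  moreover have "runs k (move_machine i MRight) ?F (?F(i := zipper (x # li) ri)) 1"
    by (rule runs_right) (use assms in auto)
  ultimately show ?thesis
    unfolding transfer_machine_def
    using assms(3) by (auto simp: fun_upd_twist intro: runs_seq)
qed

text \<open>A symbol costs five steps for the transfer and two for the loop; the failing test at the
  end adds one.\<close>

lemma runs_copy:
  assumes "i < k" "j < k" "i \<noteq> j" "F i = zipper li (xs @ ri)" "F j = zipper lj []"
    "\<And>x. x \<in> set xs \<Longrightarrow> P x \<and> length (h x) \<le> 4" "\<And>x r. ri = x # r \<Longrightarrow> \<not> P x"
  shows "runs k (copy_machine P i j h) F
    (F(i := zipper (rev xs @ li) ri, j := zipper (rev (concat (map h xs)) @ lj) []))
    (7 * length xs + 1)"
  using assms(4-)
proof (induction xs arbitrary: F li lj)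
  case Nil
  then have "runs k (copy_machine P i j h) F F 1"
    unfolding copy_machine_def One_nat_def
    by (intro runs_while_False[OF assms(1)]) (auto split: list.splits)
  then show ?case using Nil assms(3) by (simp add: fun_upd_idem)
next
  case (Cons x xs)
  let ?F = "F(i := zipper (x # li) (xs @ ri), j := zipper (rev (h x) @ lj) [])"
  let ?G = "?F(i := zipper (rev xs @ x # li) ri,
                j := zipper (rev (concat (map h xs)) @ rev (h x) @ lj) [])"
  have 1: "runs k (transfer_machine i j h) F ?F 5"
    by (rule runs_transfer) (use assms(1-3) Cons.prems in auto)
  have 2: "runs k (copy_machine P i j h) ?F ?G (7 * length xs + 1)"
    by (rule Cons.IH) (use assms(1-3) Cons.prems in auto)
  have "runs k (copy_machine P i j h) F ?G (7 * length (x # xs) + 1)"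
    unfolding copy_machine_def
    by (rule runs_while_True[OF assms(1) _ 1 2[unfolded copy_machine_def]])
      (use Cons.prems in auto)
  moreover have "?G = F(i := zipper (rev (x # xs) @ li) ri,
      j := zipper (rev (concat (map h (x # xs))) @ lj) [])"
    using assms(3) by (auto simp: fun_eq_iff)
  ultimately show ?case by metis
qed

lemma runs_skip:
  assumes "i < k" "F i = zipper li (xs @ ri)"
    "\<And>x. x \<in> set xs \<Longrightarrow> P x" "\<And>x r. ri = x # r \<Longrightarrow> \<not> P x"
  shows "runs k (skip_machine P i) F (F(i := zipper (rev xs @ li) ri)) (3 * length xs + 1)"
  using assms(2-)
proof (induction xs arbitrary: F li)
  case Nil
  then have "runs k (skip_machine P i) F F 1"
    unfolding skip_machine_def One_nat_def
    by (intro runs_while_False[OF assms(1)]) (auto split: list.splits)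
  then show ?case using Nil by (simp add: fun_upd_idem)
next
  case (Cons x xs)
  let ?F = "F(i := zipper (x # li) (xs @ ri))"
  have 1: "runs k (move_machine i MRight) F ?F 1"
    by (rule runs_right) (use assms(1) Cons.prems in auto)
  have 2: "runs k (skip_machine P i) ?F (?F(i := zipper (rev xs @ x # li) ri)) (3 * length xs + 1)"
    by (rule Cons.IH) (use assms(1) Cons.prems in auto)
  have "runs k (skip_machine P i) F (?F(i := zipper (rev xs @ x # li) ri)) (3 * length (x # xs) + 1)"
    unfolding skip_machine_def
    by (rule runs_while_True[OF assms(1) _ 1 2[unfolded skip_machine_def]])
      (use Cons.prems in auto)
  then show ?case by (simp only: fun_upd_upd rev.simps append_assoc append.simps)
qed

text \<open>The head meets \<open>xs\<close> from its last symbol on, hence the induction from the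
  right. If \<open>li\<close> is empty, the blank cell -1 ends the loop.\<close>

lemma runs_left_loop:
  assumes "i < k" "F i = left_of (rev xs @ li) ri"
    "\<And>y. y \<in> set xs \<Longrightarrow> P y" "\<And>x r. li = x # r \<Longrightarrow> \<not> P x"
  shows "runs k (while_machine i (test P) (move_machine i MLeft)) F
    (F(i := left_of li (xs @ ri))) (3 * length xs + 1)"
  using assms(2-)
proof (induction xs arbitrary: F ri rule: rev_induct)
  case Nil
  then have "runs k (while_machine i (test P) (move_machine i MLeft)) F F 1"
    unfolding One_nat_def
    by (intro runs_while_False[OF assms(1)]) (auto split: list.splits)
  then show ?case using Nil by (simp add: fun_upd_idem)
next
  case (snoc y ys)
  let ?F = "F(i := left_of (rev ys @ li) (y # ri))"
  have 1: "runs k (move_machine i MLeft) F ?F 1"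
    by (rule runs_left) (use assms(1) snoc.prems in auto)
  have 2: "runs k (while_machine i (test P) (move_machine i MLeft)) ?F
      (?F(i := left_of li (ys @ y # ri))) (3 * length ys + 1)"
    by (rule snoc.IH) (use snoc.prems in auto)
  have "runs k (while_machine i (test P) (move_machine i MLeft)) F
      (?F(i := left_of li (ys @ y # ri))) (3 * length (ys @ [y]) + 1)"
    by (rule runs_while_True[OF assms(1) _ 1 2]) (use snoc.prems in auto)
  then show ?case by (simp only: fun_upd_upd append_assoc append.simps)
qed

text \<open>The head starts just behind \<open>xs\<close>, so a move to the left precedes the loop;
  the loop overshoots by one cell, which the last move undoes.\<close>

lemma runs_rewind:
  assumes "i < k" "F i = zipper (rev xs @ li) ri"
    "\<And>y. y \<in> set xs \<Longrightarrow> P y" "\<And>x r. li = x # r \<Longrightarrow> \<not> P x"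
  shows "runs k (rewind_machine P i) F (F(i := zipper li (xs @ ri))) (3 * length xs + 3)"
proof -
  let ?F = "F(i := left_of (rev xs @ li) ri)"
  let ?G = "?F(i := left_of li (xs @ ri))"
  have 1: "runs k (move_machine i MLeft) F ?F 1"
    by (rule runs_left) (use assms in auto)
  have 2: "runs k (while_machine i (test P) (move_machine i MLeft)) ?F ?G (3 * length xs + 1)"
    by (rule runs_left_loop) (use assms in auto)
  have 3: "runs k (move_machine i MRight) ?G (?G(i := zipper li (xs @ ri))) 1"
    by (rule runs_from_left_of) (use assms in auto)
  have "runs k (rewind_machine P i) F (?G(i := zipper li (xs @ ri))) (3 * length xs + 3)"
    unfolding rewind_machine_def
    by (rule runs_seq[OF 1 runs_seq[OF 2 3 order_refl]]) simp
  then show ?thesis by (simp only: fun_upd_upd)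
qed

section \<open>Polynomials over the matrix ring\<close>

lemma word_value_simps [simp]:
  "word_value mul e \<sigma> [] = e"
  "word_value mul e \<sigma> (l # w) = mul (letter_value \<sigma> l) (word_value mul e \<sigma> w)"
  by (simp_all add: word_value_def)

lemma word_value_append:
  fixes \<sigma> :: "nat \<Rightarrow> ('q::{field,finite})^'m^'m"
  shows "word_value (**) (mat 1) \<sigma> (u @ v) =
    word_value (**) (mat 1) \<sigma> u ** word_value (**) (mat 1) \<sigma> v"
  by (induction u) (simp_all add: matrix_mul_assoc)

lemma polynomial_value_simps [simp]:
  "polynomial_value \<sigma> [] = 0"
  "polynomial_value \<sigma> (w # p) = word_value (**) (mat 1) \<sigma> w + polynomial_value \<sigma> p"
  "polynomial_value \<sigma> (p @ p') = polynomial_value \<sigma> p + polynomial_value \<sigma> p'"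
  by (simp_all add: polynomial_value_def)

text \<open>\<open>product_lists\<close> lets the first factor vary slowest, which is the order in
  which nested loops visit the summands.\<close>

definition product_polynomial :: "'c letter list list list \<Rightarrow> 'c letter list list" where
  "product_polynomial ps = map concat (product_lists ps)"

lemma product_polynomial_simps [simp]:
  "product_polynomial [] = [[]]"
  "product_polynomial (p # ps) =
     concat (map (\<lambda>w. map (\<lambda>v. w @ v) (product_polynomial ps)) p)"
  by (simp_all add: product_polynomial_def map_concat comp_def)

lemma polynomial_value_map_append:
  "polynomial_value \<sigma> (map (\<lambda>v. w @ v) p) = word_value (**) (mat 1) \<sigma> w ** polynomial_value \<sigma> p"
  by (induction p) (simp_all add: word_value_append matrix_add_ldistrib)

lemma matrix_add_mult_distrib: "(A + B) ** C = A ** C + B ** C"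
  for A B :: "('q::semiring_1)^'m^'n" and C :: "'q^'l^'m"
  by (simp add: vec_eq_iff matrix_matrix_mult_def distrib_right sum.distrib)

lemma polynomial_value_concat_append:
  "polynomial_value \<sigma> (concat (map (\<lambda>w. map (\<lambda>v. w @ v) p') p)) =
     polynomial_value \<sigma> p ** polynomial_value \<sigma> p'"
  by (induction p) (simp_all add: polynomial_value_map_append matrix_add_mult_distrib)

primrec substitute_letter :: "(nat \<Rightarrow> 'c letter list list) \<Rightarrow> 'c letter \<Rightarrow> 'c letter list list" where
  "substitute_letter s (Const c) = [[Const c]]"
| "substitute_letter s (Var i) = s i"

definition substitute ::
  "(nat \<Rightarrow> 'c letter list list) \<Rightarrow> 'c letter list list \<Rightarrow> 'c letter list list" where
  "substitute s p = concat (map (\<lambda>w. product_polynomial (map (substitute_letter s) w)) p)"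

lemma polynomial_value_substitute:
  "polynomial_value \<sigma> (substitute s p) = polynomial_value (\<lambda>i. polynomial_value \<sigma> (s i)) p"
proof -
  let ?\<tau> = "\<lambda>i. polynomial_value \<sigma> (s i)"
  have *: "polynomial_value \<sigma> (substitute_letter s l) = letter_value ?\<tau> l" for l
    by (cases l) simp_all
  have "polynomial_value \<sigma> (product_polynomial (map (substitute_letter s) w))
      = word_value (**) (mat 1) ?\<tau> w" for w
    by (induction w) (simp_all add: polynomial_value_concat_append *)
  then show ?thesis
    by (induction p) (simp_all add: substitute_def)
qed

definition expressible :: "((nat \<Rightarrow> ('q::{field,finite})^'m^'m) \<Rightarrow> 'q^'m^'m) \<Rightarrow> bool" where
  "expressible f \<longleftrightarrow> (\<exists>p\<in>lists (words_over GL). \<forall>\<sigma>. polynomial_value \<sigma> p = f \<sigma>)"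

lemma expressible_0: "expressible (\<lambda>_. 0)"
  unfolding expressible_def by (rule bexI[of _ "[]"]) auto

lemma expressible_GL: "A \<in> GL \<Longrightarrow> expressible (\<lambda>_. A)"
  unfolding expressible_def by (rule bexI[of _ "[[Const A]]"]) (auto simp: words_over_def)

lemma expressible_Var: "expressible (\<lambda>\<sigma>. \<sigma> i)"
  unfolding expressible_def by (rule bexI[of _ "[[Var i]]"]) (auto simp: words_over_def)

lemma expressible_add:
  assumes "expressible f" "expressible g"
  shows "expressible (\<lambda>\<sigma>. f \<sigma> + g \<sigma>)"
proof -
  obtain p p' where "p \<in> lists (words_over GL)" "\<forall>\<sigma>. polynomial_value \<sigma> p = f \<sigma>"
    "p' \<in> lists (words_over GL)" "\<forall>\<sigma>. polynomial_value \<sigma> p' = g \<sigma>"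
    using assms unfolding expressible_def by auto
  then show ?thesis
    unfolding expressible_def by (intro bexI[of _ "p @ p'"]) auto
qed

lemma words_over_simps [simp]:
  "[] \<in> words_over C"
  "l # w \<in> words_over C \<longleftrightarrow> l \<in> Const ` C \<union> range Var \<and> w \<in> words_over C"
  "u @ v \<in> words_over C \<longleftrightarrow> u \<in> words_over C \<and> v \<in> words_over C"
  unfolding words_over_def by simp_all

lemma concat_append_words:
  assumes "p \<in> lists (words_over C)" "p' \<in> lists (words_over C)"
  shows "concat (map (\<lambda>w. map (\<lambda>v. w @ v) p') p) \<in> lists (words_over C)"
proof -
  have "w @ v \<in> words_over C" if "w \<in> set p" "v \<in> set p'" for w v
    using assms that unfolding lists_eq_set by auto
  then show ?thesis by (auto simp: lists_eq_set)
qed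

lemma expressible_mult:
  assumes "expressible f" "expressible g"
  shows "expressible (\<lambda>\<sigma>. f \<sigma> ** g \<sigma>)"
proof -
  obtain p p' where "p \<in> lists (words_over GL)" "\<forall>\<sigma>. polynomial_value \<sigma> p = f \<sigma>"
    "p' \<in> lists (words_over GL)" "\<forall>\<sigma>. polynomial_value \<sigma> p' = g \<sigma>"
    using assms unfolding expressible_def by auto
  then show ?thesis
    unfolding expressible_def
    by (intro bexI[of _ "concat (map (\<lambda>w. map (\<lambda>v. w @ v) p') p)"] concat_append_words)
      (simp_all only: polynomial_value_concat_append simp_thms)
qed

section \<open>Matrix units as polynomials with invertible coefficients\<close>

definition matrix_unit :: "'m \<Rightarrow> 'm \<Rightarrow> 'q \<Rightarrow> ('q::{field,finite})^'m^'m" where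
  "matrix_unit i j c = (\<chi> a b. if a = i \<and> b = j then c else 0)"

lemma matrix_unit_nth: "matrix_unit i j c $ a $ b = (if a = i \<and> b = j then c else 0)"
  by (simp add: matrix_unit_def)

lemma matrix_unit_mult_left:
  "matrix_unit i j c ** M = (\<chi> a b. if a = i then c * M $ j $ b else 0)"
  by (simp add: vec_eq_iff matrix_matrix_mult_def matrix_unit_def if_distrib if_distribR
        cong: if_cong)

lemma matrix_unit_mult_right:
  "M ** matrix_unit i j c = (\<chi> a b. if b = j then M $ a $ i * c else 0)"
  by (simp add: vec_eq_iff matrix_matrix_mult_def matrix_unit_def if_distrib if_distribR
        cong: if_cong)

lemma matrix_unit_mult:
  "matrix_unit i j c ** matrix_unit j l d = matrix_unit i l (c * d)"
  "j \<noteq> j' \<Longrightarrow> matrix_unit i j c ** matrix_unit j' l d = 0"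
  by (auto simp: matrix_unit_mult_left vec_eq_iff matrix_unit_nth)

lemma matrix_unit_add: "matrix_unit i j c + matrix_unit i j d = matrix_unit i j (c + d)"
  by (auto simp: vec_eq_iff matrix_unit_nth)

text \<open>An off-diagonal matrix unit \<open>N\<close> squares to 0, so 1 + \<open>N\<close> has
  the inverse 1 - \<open>N\<close>.\<close>

lemma transvection_in_GL:
  assumes "i \<noteq> j"
  shows "mat 1 + matrix_unit i j c \<in> GL"
proof -
  have *: "(mat 1 + matrix_unit i j c) ** (mat 1 + matrix_unit i j (- c)) = mat 1" for c :: 'b
    using assms matrix_unit_add[of i j c "- c"]
    by (simp add: matrix_add_ldistrib matrix_add_mult_distrib matrix_unit_mult add.assoc)
      (simp add: vec_eq_iff matrix_unit_nth)
  show ?thesis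
    using *[of c] *[of "- c"] unfolding GL_def invertible_def by auto
qed

lemma uminus_GL: "A \<in> GL \<Longrightarrow> - A \<in> GL"
  for A :: "('q::{field,finite})^'m^'m"
proof -
  have *: "(- A) ** (- B) = A ** B" for A B :: "'q^'m^'m"
    by (simp add: vec_eq_iff matrix_matrix_mult_def)
  show "A \<in> GL \<Longrightarrow> - A \<in> GL"
    unfolding GL_def invertible_def mem_Collect_eq
    by (elim exE, rule_tac x = "- A'" in exI) (simp only: *)
qed

lemma mat_1_in_GL: "mat 1 \<in> GL"
  unfolding GL_def invertible_def by (auto intro: exI[of _ "mat 1"])

text \<open>It is the sum of a transvection and the unit \<open>- mat 1\<close>.\<close>

lemma expressible_matrix_unit_off_diagonal:
  assumes "i \<noteq> j"
  shows "expressible (\<lambda>_. matrix_unit i j c)"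
  using expressible_add[OF expressible_GL[OF transvection_in_GL[OF assms, of c]]
      expressible_GL[OF uminus_GL[OF mat_1_in_GL]]]
  by simp

text \<open>A diagonal matrix unit is the product of two off-diagonal ones through a second index
  \<open>l\<close>. In dimension one there is no such index, but then it is the scalar matrix
  \<open>mat c\<close>, which is 0 or invertible.\<close>

lemma expressible_matrix_unit:
  fixes c :: "'q::{field,finite}"
  shows "expressible (\<lambda>_. matrix_unit i j c :: 'q^'m^'m)"
proof (cases "i = j")
  case False
  then show ?thesis by (rule expressible_matrix_unit_off_diagonal)
next
  case [simp]: True
  show ?thesis
  proof (cases "\<exists>l. l \<noteq> i")
    case True
    then obtain l where "l \<noteq> i" by blast
    then show ?thesis
      using expressible_mult[OF expressible_matrix_unit_off_diagonal[of i l c]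
          expressible_matrix_unit_off_diagonal[of l i 1]]
      by (simp add: matrix_unit_mult)
  next
    case False
    have eq: "matrix_unit i j c = (mat c :: 'q^'m^'m)"
      unfolding vec_eq_iff
    proof (intro allI)
      fix a b
      have "a = i" "b = i" using False by blast+
      then show "matrix_unit i j c $ a $ b = (mat c :: 'q^'m^'m) $ a $ b"
        by (simp add: matrix_unit_nth mat_def)
    qed
    show ?thesis
    proof (cases "c = 0")
      case True
      then show ?thesis using expressible_0 by (simp add: matrix_unit_def vec_eq_iff zero_vec_def)
    next
      case c: False
      have *: "mat a ** mat b = (mat (a * b) :: 'q^'m^'m)" for a b
        by (simp add: vec_eq_iff matrix_matrix_mult_def mat_def mult_delta_left)
      have "(mat c :: 'q^'m^'m) \<in> GL"
        unfolding GL_def invertible_def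
        using c *[of c "inverse c"] *[of "inverse c" c] by auto
      then show ?thesis unfolding eq by (rule expressible_GL)
    qed
  qed
qed

text \<open>The map taking \<open>c\<close> to \<open>matrix_unit k k c\<close> is injective,
  additive and multiplicative. It embeds the field into the matrix ring and turns arithmetic with
  entries into polynomials in matrices.\<close>

definition scalar_expressible ::
  "'m \<Rightarrow> ((nat \<Rightarrow> ('q::{field,finite})^'m^'m) \<Rightarrow> 'q) \<Rightarrow> bool" where
  "scalar_expressible k f \<longleftrightarrow> expressible (\<lambda>\<sigma>. matrix_unit k k (f \<sigma>))"

lemma scalar_expressible_const: "scalar_expressible k (\<lambda>_. c)"
  unfolding scalar_expressible_def by (rule expressible_matrix_unit)

text \<open>Matrix units on both sides isolate the entry at (\<open>i\<close>, \<open>j\<close>) and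
  move it to (\<open>k\<close>, \<open>k\<close>).\<close>

lemma scalar_expressible_entry:
  "scalar_expressible k (\<lambda>\<sigma> :: nat \<Rightarrow> ('q::{field,finite})^'m^'m. \<sigma> n $ i $ j)"
proof -
  have *: "(\<lambda>\<sigma>. matrix_unit k i 1 ** \<sigma> n ** matrix_unit j k 1) =
      (\<lambda>\<sigma> :: nat \<Rightarrow> 'q^'m^'m. matrix_unit k k (\<sigma> n $ i $ j))"
    by (rule ext)
      (simp add: matrix_unit_mult_left matrix_unit_mult_right vec_eq_iff matrix_unit_nth)
  show ?thesis
    using expressible_mult[OF expressible_mult[OF expressible_matrix_unit expressible_Var]
        expressible_matrix_unit, of k i "1 :: 'q" n j k 1]
    unfolding scalar_expressible_def * .
qed

lemma scalar_expressible_diff_const: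
  "scalar_expressible k f \<Longrightarrow> scalar_expressible k (\<lambda>\<sigma>. f \<sigma> - c)"
  unfolding scalar_expressible_def
  using expressible_add[of "\<lambda>\<sigma>. matrix_unit k k (f \<sigma>)" "\<lambda>_. matrix_unit k k (- c)"]
    expressible_matrix_unit[of k k "- c"]
  by (simp add: matrix_unit_add)

lemma scalar_expressible_mult:
  "scalar_expressible k f \<Longrightarrow> scalar_expressible k g \<Longrightarrow> scalar_expressible k (\<lambda>\<sigma>. f \<sigma> * g \<sigma>)"
  unfolding scalar_expressible_def
  using expressible_mult[of "\<lambda>\<sigma>. matrix_unit k k (f \<sigma>)" "\<lambda>\<sigma>. matrix_unit k k (g \<sigma>)"]
  by (simp add: matrix_unit_mult)

lemma scalar_expressible_prod:
  "(\<And>x. x \<in> X \<Longrightarrow> scalar_expressible k (f x)) \<Longrightarrow> scalar_expressible k (\<lambda>\<sigma>. \<Prod>x\<in>X. f x \<sigma>)"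
  by (induction X rule: infinite_finite_induct)
    (auto intro: scalar_expressible_const scalar_expressible_mult)

lemma matrix_vector_mult_axis: "(M *v axis k 1) $ i = M $ i $ k"
  for M :: "('q::semiring_1)^'m^'n"
  by (simp add: matrix_vector_mult_def axis_def mult_delta_right)

text \<open>
  An entry \<open>s\<close> equals \<open>c\<close> iff \<open>s - d\<close> is nonzero for each of the finitely many scalars \<open>d \<noteq> c\<close>.
\<close>

lemma indicator_polynomial:
  fixes k :: "'m::finite"
  obtains p where "p \<in> lists (words_over GL)"
    "\<And>\<sigma> :: nat \<Rightarrow> ('q::{field,finite})^'m^'m. polynomial_value \<sigma> p \<noteq> 0 \<longleftrightarrow>
       \<sigma> 0 *v axis k 1 = 0 \<and> \<sigma> 1 = mat 1"
proof -
  define ind where "ind n i j c = (\<lambda>\<sigma> :: nat \<Rightarrow> 'q^'m^'m. \<Prod>d\<in>UNIV - {c}. \<sigma> n $ i $ j - d)" for n i j c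
  have ind: "ind n i j c \<sigma> \<noteq> 0 \<longleftrightarrow> \<sigma> n $ i $ j = c" for n i j c \<sigma>
    by (auto simp: ind_def)
  have se: "scalar_expressible k (ind n i j c)" for n i j c
    unfolding ind_def
    by (intro scalar_expressible_prod scalar_expressible_diff_const scalar_expressible_entry)
  \<comment> \<open>The first product tests column \<open>k\<close> of \<open>\<sigma> 0\<close>,
    which is the image of \<open>axis k 1\<close>; the second compares all entries of
    \<open>\<sigma> 1\<close> with those of the identity. In a field, nonvanishing of a product is a
    conjunction.\<close>
  define g where "g \<sigma> = (\<Prod>i\<in>UNIV. ind 0 i k 0 \<sigma>) * (\<Prod>i\<in>UNIV. \<Prod>j\<in>UNIV. ind 1 i j (mat 1 $ i $ j) \<sigma>)"
    for \<sigma> :: "nat \<Rightarrow> 'q^'m^'m"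
  have "scalar_expressible k g"
    unfolding g_def
    by (intro scalar_expressible_prod scalar_expressible_mult se)
  then obtain p where p: "p \<in> lists (words_over GL)"
      "\<And>\<sigma>. polynomial_value \<sigma> p = matrix_unit k k (g \<sigma>)"
    unfolding scalar_expressible_def expressible_def by auto
  have "M *v axis k 1 = 0 \<longleftrightarrow> (\<forall>i. M $ i $ k = 0)" for M :: "'q^'m^'m"
    by (simp add: matrix_vector_mult_axis vec_eq_iff)
  then have g: "g \<sigma> \<noteq> 0 \<longleftrightarrow> \<sigma> 0 *v axis k 1 = 0 \<and> \<sigma> 1 = mat 1" for \<sigma>
    using ind by (simp add: g_def vec_eq_iff)
  have "(matrix_unit k k c :: 'q^'m^'m) = 0 \<longleftrightarrow> c = 0" for c :: 'q
    by (auto simp: vec_eq_iff matrix_unit_nth)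
  then show thesis
    by (intro that[OF p(1)]) (simp only: p(2) g)
qed

section \<open>The reduction\<close>

text \<open>If \<open>v $ k\<close> is nonzero, the identity with column \<open>k\<close> replaced
  by \<open>v\<close> has determinant \<open>v $ k\<close> by Cramer's rule. Otherwise
  \<open>v + axis k 1\<close> is of that kind, and a transvection that uses a nonzero coordinate
  \<open>j\<close> of \<open>v\<close> takes the added 1 away again.\<close>

lemma nonzero_vector_from_GL:
  fixes v :: "('q::{field,finite})^'m"
  assumes "v \<noteq> 0"
  shows "\<exists>U\<in>GL. U *v axis k 1 = v"
proof -
  have *: "\<exists>U\<in>GL. U *v axis k 1 = v" if "v $ k \<noteq> 0" for v :: "'q^'m"
  proof -
    let ?U = "(\<chi> i j. if j = k then v $ i else mat 1 $ i $ j) :: 'q^'m^'m"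
    have "det ?U = v $ k"
      using cramer_lemma[of k "mat 1" v] unfolding matrix_vector_mul_lid by simp
    then have "?U \<in> GL" using that by (simp add: GL_def invertible_det_nz)
    moreover have "?U *v axis k 1 = v"
      by (simp add: matrix_vector_mult_axis vec_eq_iff)
    ultimately show ?thesis by blast
  qed
  show ?thesis
  proof (cases "v $ k = 0")
    case False
    then show ?thesis by (rule *)
  next
    case True
    obtain j where j: "v $ j \<noteq> 0" using assms by (auto simp: vec_eq_iff)
    then have "j \<noteq> k" using True by auto
    let ?T = "\<lambda>c. mat 1 + matrix_unit k j c :: 'q^'m^'m"
    have T: "?T c *v u = u + axis k (c * u $ j)" for c u
    proof -
      have "matrix_unit k j c *v u = axis k (c * u $ j)"
        by (simp add: vec_eq_iff matrix_vector_mult_def matrix_unit_nth axis_def mult_delta_left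
             if_if_eq_conj)
      then show ?thesis by (simp add: matrix_vector_mult_add_rdistrib)
    qed
    obtain U where U: "U \<in> GL" "U *v axis k 1 = v + axis k 1"
      using *[of "v + axis k 1"] True by (auto simp: axis_def)
    have "?T (- inverse (v $ j)) ** U \<in> GL"
      using U(1) transvection_in_GL[of k j "- inverse (v $ j)"] \<open>j \<noteq> k\<close>
      by (auto simp: GL_def invertible_mult)
    moreover have "(?T (- inverse (v $ j)) ** U) *v axis k 1 = v"
      using j U(2) \<open>j \<noteq> k\<close> unfolding matrix_vector_mul_assoc[symmetric] U(2) T
      by (auto simp: vec_eq_iff axis_def)
    ultimately show ?thesis by blast
  qed
qed

text \<open>There are more than two vectors, so some \<open>u\<close> differs from both 0 and
  \<open>v\<close>; then \<open>u\<close> and \<open>v - u\<close> are nonzero.\<close>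

lemma vector_from_two_GL:
  fixes v :: "('q::{field,finite})^'m"
  assumes "(CARD('m), CARD('q)) \<noteq> (1, 2)"
  shows "\<exists>U\<in>GL. \<exists>U'\<in>GL. U *v axis k 1 + U' *v axis k 1 = v"
proof -
  have "CARD('q) \<ge> 2"
    using card_mono[of UNIV "{0, 1 :: 'q}"] by simp
  have "CARD('q^'m) > 2"
  proof (cases "CARD('m) = 1")
    case True
    then show ?thesis using assms \<open>CARD('q) \<ge> 2\<close> by simp
  next
    case False
    then have "CARD('m) \<ge> 2" using zero_less_card_finite[where 'a='m] by linarith
    then have "2 ^ 2 \<le> CARD('q) ^ CARD('m)"
      using \<open>CARD('q) \<ge> 2\<close>
      by (meson le_trans one_le_numeral power_increasing power_mono zero_le_numeral)
    then show ?thesis by simp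
  qed
  moreover have "card {0, v} \<le> 2" by (simp add: card_insert_if)
  ultimately have "{0, v} \<noteq> UNIV" by (metis leD)
  then obtain u where "u \<noteq> 0" "v - u \<noteq> 0" by auto
  then obtain U U' where "U \<in> GL" "U *v axis k 1 = u" "U' \<in> GL" "U' *v axis k 1 = v - u"
    using nonzero_vector_from_GL by metis
  then show ?thesis by (intro bexI[of _ U] bexI[of _ U']) auto
qed

section \<open>Group words as sums of words in units\<close>

locale reduction =
  fixes k :: "'m::finite" and q_type :: "('q::{field,finite}) itself"
  assumes not_degenerate: "(CARD('m), CARD('q)) \<noteq> (1, 2)"
begin

text \<open>Commands may be arbitrary functions of symbols from a finite alphabet, so the two units
  can simply be chosen. They translate the constants of a word and also turn a group assignment into
  one by units.\<close>

definition first_unit :: "'q^'m \<Rightarrow> 'q^'m^'m" where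
  "first_unit v = (SOME U. U \<in> GL \<and> (\<exists>U'\<in>GL. U *v axis k 1 + U' *v axis k 1 = v))"

definition second_unit :: "'q^'m \<Rightarrow> 'q^'m^'m" where
  "second_unit v = (SOME U'. U' \<in> GL \<and> first_unit v *v axis k 1 + U' *v axis k 1 = v)"

lemma units:
  "first_unit v \<in> GL" "second_unit v \<in> GL"
  "first_unit v *v axis k 1 + second_unit v *v axis k 1 = v"
proof -
  have "\<exists>U. U \<in> GL \<and> (\<exists>U'\<in>GL. U *v axis k 1 + U' *v axis k 1 = v)"
    using vector_from_two_GL[OF not_degenerate, of k v] by blast
  then have 1: "first_unit v \<in> GL \<and> (\<exists>U'\<in>GL. first_unit v *v axis k 1 + U' *v axis k 1 = v)"
    unfolding first_unit_def by (rule someI_ex)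
  then have "\<exists>U'. U' \<in> GL \<and> first_unit v *v axis k 1 + U' *v axis k 1 = v"
    by blast
  then have "second_unit v \<in> GL \<and> first_unit v *v axis k 1 + second_unit v *v axis k 1 = v"
    unfolding second_unit_def by (rule someI_ex)
  then show "first_unit v \<in> GL" "second_unit v \<in> GL"
    "first_unit v *v axis k 1 + second_unit v *v axis k 1 = v"
    using 1 by auto
qed

text \<open>
  The indices \<open>4 * i + 2\<close>, \<open>8 * i + 4\<close> and \<open>2 * i + 1\<close> are chosen because their binary digits arise
  from those of \<open>i\<close> by prepending a fixed prefix, also for \<open>i = 0\<close>, so that the machine can
  rename variables symbol by symbol.
\<close>

primrec first_letter :: "(('q^'m) \<times> ('q^'m^'m)) letter \<Rightarrow> ('q^'m^'m) letter" where
  "first_letter (Const c) = Const (first_unit (fst c))"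
| "first_letter (Var i) = Var (4 * i + 2)"

primrec second_letter :: "(('q^'m) \<times> ('q^'m^'m)) letter \<Rightarrow> ('q^'m^'m) letter" where
  "second_letter (Const c) = Const (second_unit (fst c))"
| "second_letter (Var i) = Var (8 * i + 4)"

primrec linear_letter :: "(('q^'m) \<times> ('q^'m^'m)) letter \<Rightarrow> ('q^'m^'m) letter" where
  "linear_letter (Const c) = Const (snd c)"
| "linear_letter (Var i) = Var (2 * i + 1)"

text \<open>In the semidirect product, the vector part of (v1, A1) ... (vn, An) is the sum of the
  vectors A1 ... A(j-1) vj; as each vj comes from two units, every letter yields two words. The
  prefix \<open>u\<close> already read is a parameter because the machine keeps it on a
  tape.\<close>

fun vector_sum :: "(('q^'m) \<times> ('q^'m^'m)) letter list \<Rightarrow> (('q^'m) \<times> ('q^'m^'m)) letter list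
    \<Rightarrow> ('q^'m^'m) letter list list" where
  "vector_sum u [] = []"
| "vector_sum u (l # w) =
     [map linear_letter u @ [first_letter l], map linear_letter u @ [second_letter l]] @
     vector_sum (u @ [l]) w"

lemma linear_word_value:
  assumes "\<And>i. snd (\<sigma> i) = \<tau> (2 * i + 1)"
  shows "snd (word_value (mult Hol) \<one>\<^bsub>Hol\<^esub> \<sigma> w) =
    word_value (**) (mat 1) \<tau> (map linear_letter w)"
proof (induction w)
  case Nil
  then show ?case by (simp add: Hol_def)
next
  case (Cons l w)
  then show ?case
    by (cases l) (auto simp: Hol_def assms[symmetric, simplified] split: prod.splits)
qed

text \<open>The prefix \<open>u\<close> is a common left factor of all words. It must be arbitrary
  in the induction because the recursion lengthens it.\<close>

lemma vector_sum_value: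
  assumes "\<And>i. snd (\<sigma> i) = \<tau> (2 * i + 1)"
    and "\<And>i. fst (\<sigma> i) = \<tau> (4 * i + 2) *v axis k 1 + \<tau> (8 * i + 4) *v axis k 1"
  shows "polynomial_value \<tau> (vector_sum u w) *v axis k 1 =
    word_value (**) (mat 1) \<tau> (map linear_letter u) *v fst (word_value (mult Hol) \<one>\<^bsub>Hol\<^esub> \<sigma> w)"
proof (induction w arbitrary: u)
  case Nil
  then show ?case by (simp add: Hol_def)
next
  case (Cons l w)
  have l: "letter_value \<tau> (first_letter l) *v axis k 1 + letter_value \<tau> (second_letter l) *v axis k 1
      = fst (letter_value \<sigma> l)"
    using assms(2) units(3) by (cases l) auto
  have l': "letter_value \<tau> (linear_letter l) = snd (letter_value \<sigma> l)"
    using assms(1) by (cases l) auto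
  let ?A = "word_value (**) (mat 1) \<tau> (map linear_letter u)"
  have "polynomial_value \<tau> (vector_sum u (l # w)) *v axis k 1 =
      ?A *v (letter_value \<tau> (first_letter l) *v axis k 1 + letter_value \<tau> (second_letter l) *v axis k 1)
      + ?A *v (letter_value \<tau> (linear_letter l) *v fst (word_value (mult Hol) \<one>\<^bsub>Hol\<^esub> \<sigma> w))"
    using Cons.IH[of "u @ [l]"]
    by (simp add: word_value_append matrix_vector_mult_add_rdistrib matrix_vector_right_distrib
        matrix_vector_mul_assoc matrix_mul_assoc add.assoc)
  also have "\<dots> = ?A *v fst (word_value (mult Hol) \<one>\<^bsub>Hol\<^esub> \<sigma> (l # w))"
    unfolding l l'
    by (simp add: Hol_def matrix_vector_right_distrib split: prod.splits)
  finally show ?case .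
qed

text \<open>The fixed polynomial is known only through its values and may mention any variable.
  Sending all indices except 0 to the linear part makes the substitution total with just two sources
  to copy from.\<close>

definition parts :: "(('q^'m) \<times> ('q^'m^'m)) letter list \<Rightarrow> nat \<Rightarrow> ('q^'m^'m) letter list list" where
  "parts w i = (if i = 0 then vector_sum [] w else [map linear_letter w])"

lemma PolSat_iff:
  assumes "\<And>\<sigma> :: nat \<Rightarrow> 'q^'m^'m. polynomial_value \<sigma> p \<noteq> 0 \<longleftrightarrow>
       \<sigma> 0 *v axis k 1 = 0 \<and> \<sigma> 1 = mat 1"
  shows "accepts (PolSat Hol) w \<longleftrightarrow>
    accepts (complement RestrictedPolEquiv) (substitute (parts w) p)"
proof -
  \<comment> \<open>Both directions rest on this correspondence: given one of
    \<open>\<sigma>\<close> and \<open>\<tau>\<close>, the other is built so that the two equations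
    hold.\<close>
  have nonzero_iff: "polynomial_value \<tau> (substitute (parts w) p) \<noteq> 0 \<longleftrightarrow>
      word_value (mult Hol) \<one>\<^bsub>Hol\<^esub> \<sigma> w = \<one>\<^bsub>Hol\<^esub>"
    if "\<And>i. snd (\<sigma> i) = \<tau> (2 * i + 1)"
      "\<And>i. fst (\<sigma> i) = \<tau> (4 * i + 2) *v axis k 1 + \<tau> (8 * i + 4) *v axis k 1" for \<sigma> \<tau>
  proof -
    have "polynomial_value \<tau> (parts w 0) *v axis k 1 =
        fst (word_value (mult Hol) \<one>\<^bsub>Hol\<^esub> \<sigma> w)"
      using vector_sum_value[of \<sigma> \<tau> "[]" w] that by (simp add: parts_def)
    moreover have "polynomial_value \<tau> (parts w 1) = snd (word_value (mult Hol) \<one>\<^bsub>Hol\<^esub> \<sigma> w)"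
      using linear_word_value[of \<sigma> \<tau> w] that by (simp add: parts_def)
    moreover have "word_value (mult Hol) \<one>\<^bsub>Hol\<^esub> \<sigma> w = \<one>\<^bsub>Hol\<^esub> \<longleftrightarrow>
        fst (word_value (mult Hol) \<one>\<^bsub>Hol\<^esub> \<sigma> w) = 0 \<and>
        snd (word_value (mult Hol) \<one>\<^bsub>Hol\<^esub> \<sigma> w) = mat 1"
      by (auto simp: prod_eq_iff Hol_def)
    ultimately show ?thesis
      by (simp only: polynomial_value_substitute assms)
  qed
  show ?thesis
  proof
    assume "accepts (PolSat Hol) w"
    then obtain \<sigma> where \<sigma>: "\<sigma> \<in> UNIV \<rightarrow> carrier Hol"
      "word_value (mult Hol) \<one>\<^bsub>Hol\<^esub> \<sigma> w = \<one>\<^bsub>Hol\<^esub>"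
      by (auto simp: PolSat_def)
    \<comment> \<open>The residues odd, 2 modulo 4 and 4 modulo 8 keep the three families of
      variables apart. Multiples of 8 belong to none of them and fall into the last case, which
      supplies some unit.\<close>
    define \<tau> where "\<tau> n = (if odd n then snd (\<sigma> (n div 2))
      else if n mod 4 = 2 then first_unit (fst (\<sigma> (n div 4)))
      else second_unit (fst (\<sigma> (n div 8))))" for n
    have "snd (\<sigma> i) \<in> GL" for i
      using \<sigma>(1) by (auto simp: Hol_def GL_def Pi_def split: prod.splits) (metis prod.collapse)
    then have "\<tau> \<in> UNIV \<rightarrow> GL"
      using units(1,2) by (auto simp: \<tau>_def)
    moreover have "polynomial_value \<tau> (substitute (parts w) p) \<noteq> 0"
    proof (subst nonzero_iff[of \<sigma>])
      fix i
      show "snd (\<sigma> i) = \<tau> (2 * i + 1)" by (simp add: \<tau>_def)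
      have "(4 * i + 2) mod 4 = 2" "(4 * i + 2) div 4 = i" "(8 * i + 4) div 8 = i"
        "(8 * i + 4) mod 4 \<noteq> 2" "even (4 * i + 2)" "even (8 * i + 4)"
        by presburger+
      then show "fst (\<sigma> i) = \<tau> (4 * i + 2) *v axis k 1 + \<tau> (8 * i + 4) *v axis k 1"
        unfolding \<tau>_def by (simp only: simp_thms if_False if_True units(3))
    qed (use \<sigma>(2) in auto)
    ultimately show "accepts (complement RestrictedPolEquiv) (substitute (parts w) p)"
      by (auto simp: complement_def RestrictedPolEquiv_def)
  next
    assume "accepts (complement RestrictedPolEquiv) (substitute (parts w) p)"
    then obtain \<tau> where \<tau>: "\<tau> \<in> UNIV \<rightarrow> GL" "polynomial_value \<tau> (substitute (parts w) p) \<noteq> 0"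
      by (auto simp: complement_def RestrictedPolEquiv_def)
    define \<sigma> where
      "\<sigma> i = (\<tau> (4 * i + 2) *v axis k 1 + \<tau> (8 * i + 4) *v axis k 1, \<tau> (2 * i + 1))" for i
    have "\<sigma> \<in> UNIV \<rightarrow> carrier Hol"
      using \<tau>(1) by (auto simp: \<sigma>_def Hol_def GL_def)
    moreover have "word_value (mult Hol) \<one>\<^bsub>Hol\<^esub> \<sigma> w = \<one>\<^bsub>Hol\<^esub>"
      using nonzero_iff[of \<sigma> \<tau>] \<tau>(2) by (simp add: \<sigma>_def)
    ultimately show "accepts (PolSat Hol) w"
      by (auto simp: PolSat_def)
  qed
qed

end

lemma product_polynomial_words:
  "product_polynomial ps \<in> lists (words_over C)" if "\<forall>p\<in>set ps. p \<in> lists (words_over C)"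
  using that
  by (induction ps) (simp_all add: concat_append_words)

context reduction
begin

lemma linear_letter_words:
  "w \<in> words_over (carrier Hol) \<Longrightarrow> map linear_letter w \<in> words_over GL"
proof (induction w)
  case (Cons l w)
  then show ?case by (cases l) (auto simp: Hol_def GL_def)
qed simp

lemma vector_sum_words:
  assumes "u \<in> words_over (carrier Hol)" "w \<in> words_over (carrier Hol)"
  shows "vector_sum u w \<in> lists (words_over GL)"
  using assms
proof (induction w arbitrary: u)
  case (Cons l w)
  have "vector_sum (u @ [l]) w \<in> lists (words_over GL)"
    by (rule Cons.IH) (use Cons.prems in simp_all)
  moreover have "[first_letter l] \<in> words_over GL" "[second_letter l] \<in> words_over GL"
    using units(1,2) by (cases l; simp)+
  ultimately show ?case
    using linear_letter_words[OF Cons.prems(1)] by simp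
qed simp

end

section \<open>A machine expanding products of sums\<close>

definition inr_sum :: "'c letter list list \<Rightarrow> ('g + 'c symbol) list" where
  "inr_sum p = map Inr (encode_sum p)"

lemma encode_word_simps [simp]:
  "encode_word [] = []"
  "encode_word (l # w) = encode_letter l @ encode_word w"
  "encode_word (u @ v) = encode_word u @ encode_word v"
  by (simp_all add: encode_word_def)

lemma encode_sum_simps [simp]:
  "encode_sum [] = []"
  "encode_sum (w # p) = encode_word w @ EndSym # encode_sum p"
  "encode_sum (p @ p') = encode_sum p @ encode_sum p'"
  by (simp_all add: encode_sum_def)

lemma length_le_encode_sum: "length p \<le> length (encode_sum p)"
  by (induction p) auto

lemma inr_sum_simps [simp]:
  "inr_sum [] = []"
  "inr_sum (w # p) = map Inr (encode_word w) @ Inr EndSym # inr_sum p"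
  "inr_sum (p @ p') = inr_sum p @ inr_sum p'"
  by (simp_all add: inr_sum_def)

lemma hd_rev_inr_sum: "rev (inr_sum p) = x # r \<Longrightarrow> x = Inr EndSym"
  by (induction p rule: rev_induct) auto

lemma EndSym_notin_encode_word: "EndSym \<notin> set (encode_word w)"
proof (induction w)
  case (Cons l w)
  then show ?case by (cases l) auto
qed simp

definition not_end :: "('g + 'c symbol) \<Rightarrow> bool" where
  "not_end x \<longleftrightarrow> x \<noteq> Inr EndSym"

abbreviation everything :: "'s \<Rightarrow> bool" where
  "everything \<equiv> \<lambda>_. True"

abbreviation singleton :: "'s \<Rightarrow> 's list" where
  "singleton \<equiv> \<lambda>x. [x]"

lemma concat_map_singleton: "concat (map singleton xs) = xs"
  by (induction xs) auto

lemma runs_copy_singleton: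
  assumes "i < k" "j < k" "i \<noteq> j" "F i = zipper li (xs @ ri)" "F j = zipper lj []"
    "\<And>x. x \<in> set xs \<Longrightarrow> P x" "\<And>x r. ri = x # r \<Longrightarrow> \<not> P x"
  shows "runs k (copy_machine P i j singleton) F
    (F(i := zipper (rev xs @ li) ri, j := zipper (rev xs @ lj) [])) (7 * length xs + 1)"
  using runs_copy[OF assms(1-5), of P singleton] assms(6,7) by (simp add: concat_map_singleton)

lemma runs_rewind_all:
  assumes "i < k" "F i = zipper (rev xs) ri"
  shows "runs k (rewind_machine everything i) F (F(i := zipper [] (xs @ ri))) (3 * length xs + 3)"
  using runs_rewind[of i k F xs "[]" ri everything] assms by simp

text \<open>The head is on the start of a summand. A blank or the \<open>EndSym\<close> of the
  preceding summand lies to its left, so a rewind over \<open>not_end\<close> symbols comes back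
  exactly here.\<close>

definition word_at :: "('g + 'c symbol) tape \<Rightarrow> 'c letter list \<Rightarrow> bool" where
  "word_at t w \<longleftrightarrow> (\<exists>ls rs. t = zipper ls (map Inr (encode_word w) @ Inr EndSym # rs) \<and>
     (\<forall>x r. ls = x # r \<longrightarrow> x = Inr EndSym))"

text \<open>Rewinding after each copy puts the head back on the start of its summand, so the loop
  counters are preserved.\<close>

primrec emit_machine :: "nat list \<Rightarrow> ('g + 'c symbol) machine" where
  "emit_machine [] = []"
| "emit_machine (i # is) = copy_machine not_end i 1 singleton \<then> rewind_machine not_end i \<then>
     emit_machine is"

text \<open>
  The tapes \<open>all\<close> hold the factors, the heads being the counters of nested loops over the summands.
\<close>

primrec expand_machine :: "nat list \<Rightarrow> nat list \<Rightarrow> ('g + 'c symbol) machine" where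
  "expand_machine all [] = emit_machine all \<then> put_machine 1 (Inr EndSym)"
| "expand_machine all (i # is) =
     while_machine i (test everything)
       (expand_machine all is \<then> skip_machine not_end i \<then> move_machine i MRight) \<then>
     rewind_machine everything i"

lemma well_formed_emit [simp, intro]: "well_formed (emit_machine is)"
  by (induction "is") auto

lemma well_formed_expand [simp, intro]: "well_formed (expand_machine all is)"
  by (induction "is") auto

lemma runs_emit_one:
  assumes "i < k" "1 < k" "i \<noteq> 1" "F 1 = zipper (rev (map Inr out)) []" "word_at (F i) w"
    "length (encode_word w) \<le> L"
  shows "runs k (copy_machine not_end i 1 singleton \<then> rewind_machine not_end i) F
    (F(1 := zipper (rev (map Inr (out @ encode_word w))) [])) (10 * L + 4)"
proof -
  obtain ls rs where i: "F i = zipper ls (map Inr (encode_word w) @ Inr EndSym # rs)"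
    and ls: "\<forall>x r. ls = x # r \<longrightarrow> x = Inr EndSym"
    using assms(5) by (auto simp: word_at_def)
  let ?w = "map Inr (encode_word w) :: ('a + 'b symbol) list"
  let ?F = "F(i := zipper (rev ?w @ ls) (Inr EndSym # rs),
      1 := zipper (rev ?w @ rev (map Inr out)) [])"
  have ne: "not_end x" if "x \<in> set ?w" for x
    using that EndSym_notin_encode_word[of w] by (auto simp: not_end_def)
  have 1: "runs k (copy_machine not_end i 1 singleton) F ?F (7 * length ?w + 1)"
    by (rule runs_copy_singleton[OF assms(1-3) i assms(4)]) (use ne in \<open>auto simp: not_end_def\<close>)
  have 2: "runs k (rewind_machine not_end i) ?F
      (?F(i := zipper ls (?w @ Inr EndSym # rs))) (3 * length ?w + 3)"
    by (rule runs_rewind) (use assms(1,3) ls ne in \<open>auto simp: not_end_def\<close>)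
  have "?F(i := zipper ls (?w @ Inr EndSym # rs)) =
      F(1 := zipper (rev (map Inr (out @ encode_word w))) [])"
    using assms(3) i by (auto simp: fun_eq_iff)
  then show ?thesis
    using runs_seq[OF 1 2, of "10 * L + 4"] assms(6) by simp
qed

lemma seq_machine_assoc: "(M \<then> N) \<then> R = M \<then> N \<then> R"
  by (simp add: seq_machine_def relocate_def fun_eq_iff add.assoc)

lemma runs_emit:
  assumes "1 < k" "\<forall>i\<in>set is. i < k \<and> i \<noteq> 1 \<and> word_at (F i) (cur i) \<and> length (encode_word (cur i)) \<le> L"
    "F 1 = zipper (rev (map Inr out)) []"
  shows "runs k (emit_machine is) F
    (F(1 := zipper (rev (map Inr (out @ encode_word (concat (map cur is))))) []))
    (length is * (10 * L + 4))"
  using assms(2,3)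
proof (induction "is" arbitrary: F out)
  case Nil
  then show ?case using runs_Nil[of k F 0] by (simp add: fun_upd_idem)
next
  case (Cons i "is")
  let ?F = "F(1 := zipper (rev (map Inr (out @ encode_word (cur i)))) [])"
  have 1: "runs k (copy_machine not_end i 1 singleton \<then> rewind_machine not_end i) F ?F (10 * L + 4)"
    by (rule runs_emit_one) (use assms(1) Cons.prems in auto)
  have 2: "runs k (emit_machine is) ?F
      (?F(1 := zipper (rev (map Inr ((out @ encode_word (cur i)) @ encode_word (concat (map cur is))))) []))
      (length is * (10 * L + 4))"
    by (rule Cons.IH) (use Cons.prems in auto)
  have "runs k (emit_machine (i # is)) F
      (?F(1 := zipper (rev (map Inr ((out @ encode_word (cur i)) @ encode_word (concat (map cur is))))) []))
      (length (i # is) * (10 * L + 4))"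
    using runs_seq[OF 1 2] by (simp add: seq_machine_assoc)
  then show ?case
    by (simp only: fun_upd_upd append_assoc encode_word_simps concat.simps list.map)
qed

text \<open>One more factor means a loop of at most \<open>L\<close> rounds, each with the inner
  run, the skip over a summand, the move over \<open>EndSym\<close> and the loop overhead; a last
  test and a rewind follow. For a fixed number of factors this is polynomial in
  \<open>L\<close>.\<close>

primrec expand_time :: "nat \<Rightarrow> nat \<Rightarrow> nat \<Rightarrow> nat" where
  "expand_time a 0 L = a * (10 * L + 4) + 1"
| "expand_time a (Suc n) L = L * (expand_time a n L + 3 * L + 4) + 3 * L + 4"

text \<open>\<open>js\<close> are the tapes of the enclosing loops, resting on the summands
  \<open>cur\<close>; \<open>is\<close> are those of the loops still to be run. Each loop rewinds
  its tape at the end, so only tape 1 changes and an enclosing loop can start the inner ones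
  afresh.\<close>

lemma runs_expand:
  assumes "1 < k" "all = js @ is" "distinct all" "\<forall>i\<in>set all. i < k \<and> i \<noteq> 1"
    "\<forall>j\<in>set js. word_at (F j) (cur j) \<and> length (encode_word (cur j)) \<le> L"
    "\<forall>i\<in>set is. F i = zipper [] (inr_sum (p i)) \<and> length (encode_sum (p i)) \<le> L"
    "F 1 = zipper (rev (map Inr out)) []"
  shows "runs k (expand_machine all is) F
    (F(1 := zipper (rev (map Inr (out @ encode_sum
       (map (\<lambda>t. concat (map cur js) @ t) (product_polynomial (map p is)))))) []))
    (expand_time (length all) (length is) L)"
  using assms(2,5-)
proof (induction "is" arbitrary: js F cur out)
  case Nil
  let ?F = "F(1 := zipper (rev (map Inr (out @ encode_word (concat (map cur all))))) [])"
  have 1: "runs k (emit_machine all) F ?F (length all * (10 * L + 4))"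
    by (rule runs_emit) (use assms(1,4) Nil in auto)
  have 2: "runs k (put_machine 1 (Inr EndSym)) ?F
      (?F(1 := zipper (Inr EndSym # rev (map Inr (out @ encode_word (concat (map cur all))))) [])) 1"
    by (rule runs_put) (use assms(1) in auto)
  have "runs k (expand_machine all []) F
      (?F(1 := zipper (Inr EndSym # rev (map Inr (out @ encode_word (concat (map cur all))))) []))
      (expand_time (length all) (length []) L)"
    using runs_seq[OF 1 2] by simp
  moreover have eq: "Inr EndSym # rev (map Inr (out @ encode_word (concat (map cur all)))) =
      rev (map Inr (out @ encode_sum (map (\<lambda>t. concat (map cur js) @ t) (product_polynomial (map p [])))))"
    using Nil.prems(1) by simp
  ultimately show ?case unfolding eq fun_upd_upd by (simp only:)
next
  case (Cons i "is")
  let ?pp = "product_polynomial (map p is)"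
  let ?C = "concat (map cur js)"
  let ?T = "expand_time (length all) (length is) L"
  let ?body = "expand_machine all is \<then> skip_machine not_end i \<then> move_machine i MRight"
  let ?st = "\<lambda>u v out. F(i := zipper (rev (inr_sum u)) (inr_sum v), 1 := zipper (rev (map Inr out)) [])"
  let ?words = "\<lambda>v. concat (map (\<lambda>w. map (\<lambda>t. ?C @ w @ t) ?pp) v)"
  have i: "i < k" "i \<noteq> 1" "i \<notin> set js" "i \<notin> set is" "1 \<notin> set js" "1 \<notin> set is" "i \<in> set all"
    using assms(3,4) Cons.prems(1) by auto
  have body: "runs k ?body (?st u (w # v) out) (?st (u @ [w]) v (out @ encode_sum (map (\<lambda>t. ?C @ w @ t) ?pp)))
      (?T + 3 * L + 2)" if len: "length (encode_word w) \<le> L" for u w v out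
  proof -
    let ?F = "?st u (w # v) out"
    \<comment> \<open>For the inner run, tape \<open>i\<close> joins the enclosing loops, with
      \<open>w\<close> as its current summand.\<close>
    let ?out = "out @ encode_sum (map (\<lambda>t. concat (map (cur(i := w)) (js @ [i])) @ t) ?pp)"
    have out: "?out = out @ encode_sum (map (\<lambda>t. ?C @ w @ t) ?pp)"
      using i(3) by (simp add: map_fun_upd)
    let ?G = "?F(1 := zipper (rev (map Inr ?out)) [])"
    let ?w = "map Inr (encode_word w) :: ('a + 'b symbol) list"
    have "word_at (?F i) w"
      using i(2) hd_rev_inr_sum[of u] by (auto simp: word_at_def)
    then have 1: "runs k (expand_machine all is) ?F ?G ?T"
      using i len Cons.prems assms(4) by (intro Cons.IH) auto
    let ?H = "?G(i := zipper (rev ?w @ rev (inr_sum u)) (Inr EndSym # inr_sum v))"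
    have ne: "not_end x" if "x \<in> set ?w" for x
      using that EndSym_notin_encode_word[of w] by (auto simp: not_end_def)
    have 2: "runs k (skip_machine not_end i) ?G ?H (3 * length ?w + 1)"
      by (rule runs_skip[OF i(1)]) (use i(2) ne in \<open>auto simp: not_end_def\<close>)
    let ?I = "?H(i := zipper (Inr EndSym # rev ?w @ rev (inr_sum u)) (inr_sum v))"
    have 3: "runs k (move_machine i MRight) ?H ?I 1"
      by (rule runs_right) (use i in auto)
    have "?I = ?st (u @ [w]) v (out @ encode_sum (map (\<lambda>t. ?C @ w @ t) ?pp))"
      unfolding out using i(2) by (auto simp: fun_eq_iff)
    moreover have "runs k ?body ?F ?I (?T + 3 * L + 2)"
      by (rule runs_seq[OF 1 runs_seq[OF 2 3 order_refl]]) (use len in simp)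
    ultimately show ?thesis by metis
  qed
  have loop: "runs k (while_machine i (test everything) ?body) (?st u v out)
      (?st (u @ v) [] (out @ encode_sum (?words v))) (length v * (?T + 3 * L + 4) + 1)"
    if "\<forall>w\<in>set v. length (encode_word w) \<le> L" for u v out
    using that
  proof (induction v arbitrary: u out)
    case Nil
    have "\<not> test everything (scan (?st u [] out i))"
      using i by simp
    from runs_while_False[of i k "test everything" "?st u [] out", OF i(1) this, of ?body 0] show ?case
      by (simp only: append_Nil2 list.map concat.simps encode_sum_simps list.size mult_0 add_0
          One_nat_def)
  next
    case (Cons w v)
    let ?out = "out @ encode_sum (map (\<lambda>t. ?C @ w @ t) ?pp)"
    have 1: "runs k ?body (?st u (w # v) out) (?st (u @ [w]) v ?out) (?T + 3 * L + 2)"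
      by (rule body) (use Cons.prems in auto)
    have 2: "runs k (while_machine i (test everything) ?body) (?st (u @ [w]) v ?out)
      (?st ((u @ [w]) @ v) [] (?out @ encode_sum (?words v))) (length v * (?T + 3 * L + 4) + 1)"
      by (rule Cons.IH) (use Cons.prems in auto)
    have "runs k (while_machine i (test everything) ?body) (?st u (w # v) out)
      (?st ((u @ [w]) @ v) [] (?out @ encode_sum (?words v))) (length (w # v) * (?T + 3 * L + 4) + 1)"
      by (rule runs_while_True[OF i(1) _ 1 2]) (use i in \<open>auto split: list.splits\<close>)
    then show ?case by (simp only: append_assoc append.simps concat.simps list.map encode_sum_simps)
  qed
  have len: "length (encode_sum (p i)) \<le> L" and Fi: "F i = zipper [] (inr_sum (p i))"
    using Cons.prems by auto
  have "length (encode_word w) \<le> length (encode_sum q)" if "w \<in> set q" for w :: "'b letter list" and q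
    using that by (induction q) auto
  then have "\<forall>w\<in>set (p i). length (encode_word w) \<le> L"
    using len by (meson le_trans)
  from loop[OF this, of "[]" out]
  have 1: "runs k (while_machine i (test everything) ?body) F
      (?st (p i) [] (out @ encode_sum (?words (p i)))) (length (p i) * (?T + 3 * L + 4) + 1)"
    using Cons.prems Fi i by (simp add: fun_upd_idem)
  let ?G = "?st (p i) [] (out @ encode_sum (?words (p i)))"
  have 2: "runs k (rewind_machine everything i) ?G
     (?G(i := zipper [] (inr_sum (p i) @ []))) (3 * length (inr_sum (p i) :: ('a + 'b symbol) list) + 3)"
    by (rule runs_rewind) (use i in auto)
  have eq: "?G(i := zipper [] (inr_sum (p i) @ [])) =
     F(1 := zipper (rev (map Inr (out @ encode_sum
       (map (\<lambda>t. concat (map cur js) @ t) (product_polynomial (map p (i # is))))))) [])"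
    using i Fi by (auto simp: fun_eq_iff map_concat comp_def)
  have "length (p i) \<le> L" using len length_le_encode_sum[of "p i"] by simp
  then have bound: "length (p i) * (?T + 3 * L + 4) \<le> L * (?T + 3 * L + 4)"
    by (rule mult_le_mono1)
  then have "length (p i) * (?T + 3 * L + 4) + 1 + (3 * length (inr_sum (p i) :: ('a + 'b symbol) list) + 3)
      \<le> expand_time (length all) (length (i # is)) L"
    unfolding inr_sum_def length_map length_Cons expand_time.simps using len bound by linarith
  from runs_seq[OF 1 2 this] show ?case
    unfolding eq expand_machine.simps .
qed

section \<open>A machine for the substitution\<close>

text \<open>Tape layout: 0 input, 1 output, 2 the prefix read so far, 3 the sum \<open>S\<close>, 4
  the word \<open>Q\<close>, and from 5 on one tape for each letter occurrence in the fixed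
  polynomial.\<close>

definition source :: "nat \<Rightarrow> nat" where
  "source v = (if v = 0 then 3 else 4)"

primrec load_machine :: "nat \<Rightarrow> 'c letter \<Rightarrow> ('g + 'c symbol) machine" where
  "load_machine i (Const c) = put_machine i (Inr (ConstSym c)) \<then> put_machine i (Inr EndSym) \<then>
     rewind_machine everything i"
| "load_machine i (Var v) = rewind_machine everything (source v) \<then>
     copy_machine everything (source v) i singleton \<then> rewind_machine everything i"

primrec load_all_machine :: "nat \<Rightarrow> 'c letter list \<Rightarrow> ('g + 'c symbol) machine" where
  "load_all_machine i [] = []"
| "load_all_machine i (l # w) = load_machine i l \<then> load_all_machine (Suc i) w"

text \<open>Each summand of the polynomial gets tapes of its own, which are still blank, so nothing
  has to be erased.\<close>

primrec substitute_machine :: "nat \<Rightarrow> 'c letter list list \<Rightarrow> ('g + 'c symbol) machine" where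
  "substitute_machine i [] = []"
| "substitute_machine i (w # p) = load_all_machine i w \<then>
     expand_machine [i..<i + length w] [i..<i + length w] \<then> substitute_machine (i + length w) p"

lemma well_formed_substitute [simp, intro]: "well_formed (substitute_machine i p)"
proof -
  have 1: "well_formed (load_machine i l)" for i and l :: "'b letter"
    by (cases l) auto
  have "well_formed (load_all_machine i w)" for i and w :: "'b letter list"
    by (induction w arbitrary: i) (auto simp: 1)
  then show ?thesis by (induction p arbitrary: i) auto
qed

text \<open>Source heads stand at the right end, where rewinding and copying leave them again, so a
  source can be read repeatedly. \<open>2 \<le> L\<close> covers a loaded constant: one symbol and
  its \<open>EndSym\<close>.\<close>

definition sources :: "(nat \<Rightarrow> ('g + 'c symbol) tape) \<Rightarrow> (nat \<Rightarrow> 'c letter list list) \<Rightarrow> nat \<Rightarrow> bool" where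
  "sources F s L \<longleftrightarrow> 2 \<le> L \<and>
     (\<forall>v. F (source v) = zipper (rev (inr_sum (s v))) [] \<and> length (encode_sum (s v)) \<le> L)"

lemma runs_load:
  assumes "i < k" "5 \<le> i" "F i = zipper [] []" "sources F s L"
  shows "runs k (load_machine i l) F
    (F(i := zipper [] (inr_sum (substitute_letter s l)))) (13 * L + 8)"
proof (cases l)
  case (Const c)
  let ?F = "F(i := zipper [Inr (ConstSym c)] [])"
  let ?G = "?F(i := zipper [Inr EndSym, Inr (ConstSym c)] [])"
  have 1: "runs k (put_machine i (Inr (ConstSym c))) F ?F 1"
    by (rule runs_put) (use assms in auto)
  have 2: "runs k (put_machine i (Inr EndSym)) ?F ?G 1"
    by (rule runs_put) (use assms in auto)
  have 3: "runs k (rewind_machine everything i) ?G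
      (?G(i := zipper [] ([Inr (ConstSym c), Inr EndSym] @ []))) (3 * length [Inr (ConstSym c), Inr EndSym :: 'a + 'b symbol] + 3)"
    by (rule runs_rewind_all) (use assms in auto)
  show ?thesis
    using runs_seq[OF 1 runs_seq[OF 2 3 order_refl], of "13 * L + 8"] Const assms(4)
    by (simp add: sources_def)
next
  case (Var v)
  let ?x = "inr_sum (s v) :: ('a + 'b symbol) list"
  let ?v = "source v"
  have v: "F ?v = zipper (rev ?x @ []) []" "length ?x \<le> L" "?v < k" "?v \<noteq> i"
    using assms by (auto simp: sources_def inr_sum_def source_def)
  let ?F = "F(?v := zipper [] (?x @ []))"
  let ?G = "?F(?v := zipper (rev ?x @ []) [], i := zipper (rev ?x @ []) [])"
  have 1: "runs k (rewind_machine everything ?v) F ?F (3 * length ?x + 3)"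
    by (rule runs_rewind) (use v in auto)
  have 2: "runs k (copy_machine everything ?v i singleton) ?F ?G (7 * length ?x + 1)"
    by (rule runs_copy_singleton) (use assms v in auto)
  have 3: "runs k (rewind_machine everything i) ?G
      (?G(i := zipper [] (?x @ []))) (3 * length ?x + 3)"
    by (rule runs_rewind) (use assms in auto)
  have "?G(i := zipper [] (?x @ [])) = F(i := zipper [] (inr_sum (substitute_letter s l)))"
    using v Var by (auto simp: fun_eq_iff)
  then show ?thesis
    using runs_seq[OF 1 runs_seq[OF 2 3 order_refl], of "13 * L + 8"] Var v(2) by simp
qed

lemma runs_load_all:
  assumes "i + length w \<le> k" "5 \<le> i" "\<forall>j\<ge>i. F j = zipper [] []" "sources F s L"
  shows "\<exists>G. runs k (load_all_machine i w) F G (length w * (13 * L + 8)) \<and>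
    (\<forall>j<length w. G (i + j) = zipper [] (inr_sum (substitute_letter s (w ! j)))) \<and>
    (\<forall>j. j < i \<or> i + length w \<le> j \<longrightarrow> G j = F j)"
  using assms
proof (induction w arbitrary: i F)
  case Nil
  then show ?case using runs_Nil[of k F 0] by auto
next
  case (Cons l w)
  let ?F = "F(i := zipper [] (inr_sum (substitute_letter s l)))"
  have 1: "runs k (load_machine i l) F ?F (13 * L + 8)"
    by (rule runs_load) (use Cons.prems in auto)
  have F: "sources ?F s L"
    using Cons.prems by (auto simp: sources_def source_def)
  have "\<exists>G. runs k (load_all_machine (Suc i) w) ?F G (length w * (13 * L + 8)) \<and>
    (\<forall>j<length w. G (Suc i + j) = zipper [] (inr_sum (substitute_letter s (w ! j)))) \<and>
    (\<forall>j. j < Suc i \<or> Suc i + length w \<le> j \<longrightarrow> G j = ?F j)"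
  proof (rule Cons.IH[of "Suc i" ?F])
    show "sources ?F s L" by (rule F)
  qed (use Cons.prems in auto)
  then obtain G where G: "runs k (load_all_machine (Suc i) w) ?F G (length w * (13 * L + 8))"
    "\<forall>j<length w. G (Suc i + j) = zipper [] (inr_sum (substitute_letter s (w ! j)))"
    "\<forall>j. j < Suc i \<or> Suc i + length w \<le> j \<longrightarrow> G j = ?F j"
    by blast
  have "runs k (load_all_machine i (l # w)) F G (length (l # w) * (13 * L + 8))"
    unfolding load_all_machine.simps by (rule runs_seq[OF 1 G(1)]) simp
  moreover have "G (i + j) = zipper [] (inr_sum (substitute_letter s ((l # w) ! j)))"
    if "j < length (l # w)" for j
    using that G(2,3) by (cases j) auto
  moreover have "G j = F j" if "j < i \<or> i + length (l # w) \<le> j" for j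
    using that G(3) by auto
  ultimately show ?case by blast
qed

primrec substitute_time :: "'c letter list list \<Rightarrow> nat \<Rightarrow> nat" where
  "substitute_time [] L = 0"
| "substitute_time (w # p) L =
     length w * (13 * L + 8) + expand_time (length w) (length w) L + substitute_time p L"

lemma runs_substitute:
  assumes "i + sum_list (map length p) \<le> k" "5 \<le> i" "\<forall>j\<ge>i. F j = zipper [] []" "sources F s L"
    "F 1 = zipper (rev (map Inr out)) []"
  shows "\<exists>G. runs k (substitute_machine i p) F G (substitute_time p L) \<and>
    G 1 = zipper (rev (map Inr (out @ encode_sum (substitute s p)))) []"
  using assms
proof (induction p arbitrary: i F out)
  case Nil
  then show ?case using runs_Nil[of k F 0] by (auto simp: substitute_def)
next
  case (Cons w p)
  let ?n = "i + length w"
  let ?is = "[i..<?n]"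
  let ?p = "\<lambda>j. substitute_letter s (w ! (j - i))"
  obtain G where G: "runs k (load_all_machine i w) F G (length w * (13 * L + 8))"
    "\<forall>j<length w. G (i + j) = zipper [] (inr_sum (substitute_letter s (w ! j)))"
    "\<forall>j. j < i \<or> ?n \<le> j \<longrightarrow> G j = F j"
    using runs_load_all[of i w k F s L] Cons.prems by auto
  have G1: "G 1 = zipper (rev (map Inr out)) []"
    using G(3) Cons.prems by auto
  have L: "length (encode_sum (substitute_letter s l)) \<le> L" for l
    using Cons.prems(4) by (cases l) (auto simp: sources_def)
  \<comment> \<open>There is no enclosing loop yet, so the prefix before \<open>t\<close> is empty
    and \<open>\<lambda>_. w\<close> is a mere default for the current summands.\<close>
  let ?out = "out @ encode_sum (map (\<lambda>t. concat (map (\<lambda>_. w) ([] :: nat list)) @ t) (product_polynomial (map ?p ?is)))"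
  let ?H = "G(1 := zipper (rev (map Inr ?out)) [])"
  have H: "runs k (expand_machine ?is ?is) G ?H (expand_time (length ?is) (length ?is) L)"
  proof (rule runs_expand[of k ?is "[]" ?is G "\<lambda>_. w" L ?p out])
    show "\<forall>j\<in>set ?is. G j = zipper [] (inr_sum (?p j)) \<and> length (encode_sum (?p j)) \<le> L"
    proof
      fix j assume "j \<in> set ?is"
      then show "G j = zipper [] (inr_sum (?p j)) \<and> length (encode_sum (?p j)) \<le> L"
        using G(2)[rule_format, of "j - i"] L by auto
    qed
  qed (use Cons.prems G1 in auto)
  have "map ?p ?is = map (substitute_letter s) w"
    by (rule nth_equalityI) auto
  then have out: "?out = out @ encode_sum (product_polynomial (map (substitute_letter s) w))"
    by simp
  have H': "sources ?H s L"
    using G(3) Cons.prems by (auto simp: sources_def source_def)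
  have "\<exists>I. runs k (substitute_machine ?n p) ?H I (substitute_time p L) \<and>
      I 1 = zipper (rev (map Inr (?out @ encode_sum (substitute s p)))) []"
  proof (rule Cons.IH[of ?n ?H ?out])
    show "sources ?H s L" by (rule H')
  qed (use Cons.prems G(3) in auto)
  then obtain I where I: "runs k (substitute_machine ?n p) ?H I (substitute_time p L)"
    "I 1 = zipper (rev (map Inr (?out @ encode_sum (substitute s p)))) []"
    by blast
  have "runs k (substitute_machine i (w # p)) F I (substitute_time (w # p) L)"
    unfolding substitute_machine.simps
    by (rule runs_seq[OF G(1) runs_seq[OF H I(1) order_refl]]) simp
  moreover have "?out @ encode_sum (substitute s p) = out @ encode_sum (substitute s (w # p))"
    unfolding out by (simp add: substitute_def)
  ultimately show ?case using I(2) by metis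
qed

section \<open>Polynomial bounds\<close>

text \<open>With the base \<open>Suc n\<close>, powers grow with the exponent also at
  \<open>n = 0\<close>, so exponents can be raised freely when bounds are added.\<close>

definition poly_bounded :: "(nat \<Rightarrow> nat) \<Rightarrow> bool" where
  "poly_bounded f \<longleftrightarrow> (\<exists>c d. \<forall>n. f n \<le> c * Suc n ^ d)"

lemma poly_bounded_const: "poly_bounded (\<lambda>_. c)"
  unfolding poly_bounded_def by (intro exI[of _ c] exI[of _ 0]) simp

lemma poly_bounded_id: "poly_bounded (\<lambda>n. n)"
  unfolding poly_bounded_def by (intro exI[of _ 1]) simp

lemma poly_bounded_add:
  assumes "poly_bounded f" "poly_bounded g"
  shows "poly_bounded (\<lambda>n. f n + g n)"
proof -
  obtain c d c' d' where *: "\<And>n. f n \<le> c * Suc n ^ d" "\<And>n. g n \<le> c' * Suc n ^ d'"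
    using assms unfolding poly_bounded_def by blast
  have "f n + g n \<le> (c + c') * Suc n ^ (d + d')" for n
  proof -
    have "c * Suc n ^ d \<le> c * Suc n ^ (d + d')" "c' * Suc n ^ d' \<le> c' * Suc n ^ (d + d')"
      by (intro mult_le_mono2 power_increasing; simp)+
    then show ?thesis using *[of n] by (simp only: add_mult_distrib)
  qed
  then show ?thesis unfolding poly_bounded_def by blast
qed

lemma poly_bounded_mult:
  assumes "poly_bounded f" "poly_bounded g"
  shows "poly_bounded (\<lambda>n. f n * g n)"
proof -
  obtain c d c' d' where *: "\<And>n. f n \<le> c * Suc n ^ d" "\<And>n. g n \<le> c' * Suc n ^ d'"
    using assms unfolding poly_bounded_def by blast
  have "f n * g n \<le> (c * c') * Suc n ^ (d + d')" for n
    using mult_le_mono[OF *(1)[of n] *(2)[of n]] by (simp only: power_add ac_simps)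
  then show ?thesis unfolding poly_bounded_def by blast
qed

lemma poly_bounded_Suc: "poly_bounded f \<Longrightarrow> poly_bounded (\<lambda>n. Suc (f n))"
  using poly_bounded_add[OF _ poly_bounded_const[of 1]] by simp

lemmas poly_bounded_intros =
  poly_bounded_Suc poly_bounded_const poly_bounded_id poly_bounded_add poly_bounded_mult

lemma poly_bounded_substitute_time:
  assumes "poly_bounded L"
  shows "poly_bounded (\<lambda>n. substitute_time p (L n))"
proof -
  have "poly_bounded (\<lambda>n. expand_time a b (L n))" for a b
    by (induction b) (simp_all add: poly_bounded_intros assms)
  then show ?thesis
    by (induction p) (simp_all add: poly_bounded_intros assms)
qed

text \<open>For positive \<open>n\<close>, \<open>Suc n \<le> 2 * n\<close> gives the factor
  \<open>2 ^ d\<close>; the additive constant covers \<open>n = 0\<close>.\<close>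

lemma poly_boundedE:
  assumes "poly_bounded f"
  obtains c d where "\<And>n. f n \<le> c * n ^ d + c"
proof -
  obtain c d where f: "\<And>n. f n \<le> c * Suc n ^ d"
    using assms unfolding poly_bounded_def by blast
  have "f n \<le> (c * 2 ^ d) * n ^ d + c * 2 ^ d" for n
  proof (cases "n = 0")
    case True
    have "c \<le> c * 2 ^ d" by simp
    moreover have "f n \<le> c" using f[of 0] True by simp
    ultimately show ?thesis by linarith
  next
    case False
    then have "Suc n ^ d \<le> (2 * n) ^ d" by (intro power_mono) auto
    then have "c * Suc n ^ d \<le> c * (2 * n) ^ d" by (rule mult_le_mono2)
    then have "c * Suc n ^ d \<le> c * 2 ^ d * n ^ d" by (simp only: power_mult_distrib mult.assoc)
    then show ?thesis using f[of n] by linarith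
  qed
  then show thesis by (rule that)
qed

section \<open>A machine for the reduction\<close>

fun translate :: "('c \<Rightarrow> 'd) \<Rightarrow> bool list \<Rightarrow> 'c symbol \<Rightarrow> 'd symbol list" where
  "translate f bs (ConstSym c) = [ConstSym (f c)]"
| "translate f bs VarSym = VarSym # map BitSym bs"
| "translate f bs (BitSym b) = [BitSym b]"
| "translate f bs EndSym = [EndSym]"

definition lift :: "('g symbol \<Rightarrow> 'c symbol list) \<Rightarrow> ('g symbol + 'c symbol) \<Rightarrow> ('g symbol + 'c symbol) list" where
  "lift h = case_sum (\<lambda>s. map Inr (h s)) (\<lambda>y. [Inr y])"

lemma concat_map_lift: "concat (map (lift h) (map Inl xs)) = map Inr (concat (map h xs))"
  by (induction xs) (simp_all add: lift_def)

lemma length_lift: "(\<And>s. length (h s) \<le> 4) \<Longrightarrow> length (lift h x) \<le> 4"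
  by (cases x) (simp_all add: lift_def)

lemma length_translate: "length bs \<le> 3 \<Longrightarrow> length (translate f bs s) \<le> 4"
  by (cases s) simp_all

lemma concat_map_translate_bits: "concat (map (translate f bs) (map BitSym cs)) = map BitSym cs"
  by (induction cs) simp_all

text \<open>Letters carry no terminator. A letter is one symbol other than a bit, followed by all
  bits up to the next such symbol, so this predicate finds its ends on the input tape in both
  directions.\<close>

fun is_bit :: "('g symbol + 'c symbol) \<Rightarrow> bool" where
  "is_bit (Inl (BitSym b)) = True"
| "is_bit _ = False"

lemma encode_letter_cases:
  obtains x b where "encode_letter l = x # map BitSym b" "\<And>c. x \<noteq> BitSym c"
  by (cases l) (auto intro: that[of _ "[]"])

lemma is_bit_hd_encode_word:
  assumes "map Inl (encode_word w) = (x :: 'g symbol + 'c symbol) # r"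
  shows "\<not> is_bit x"
proof (cases w)
  case (Cons l w')
  then show ?thesis using assms by (cases l) auto
qed (use assms in simp)

lemma binary_rec: "n \<noteq> 0 \<Longrightarrow> binary n = odd n # binary (n div 2)"
  by (subst binary.simps) simp

lemma binary_shift:
  "binary (2 * i + 1) = True # binary i"
  "binary (4 * i + 2) = False # True # binary i"
  "binary (8 * i + 4) = False # False # True # binary i"
proof -
  show *: "binary (2 * i + 1) = True # binary i" for i
    by (simp add: binary_rec)
  have **: "binary (4 * i + 2) = False # True # binary i" for i
    using *[of i] binary_rec[of "4 * i + 2"] by simp
  show "binary (4 * i + 2) = False # True # binary i"
    by (rule **)
  show "binary (8 * i + 4) = False # False # True # binary i"
    using **[of i] binary_rec[of "8 * i + 4"] by simp
qed

context reduction
begin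

definition "first_symbol = translate (first_unit \<circ> fst) [False, True]"
definition "second_symbol = translate (second_unit \<circ> fst) [False, False, True]"
definition "linear_symbol = (translate snd [True] :: (('q^'m) \<times> ('q^'m^'m)) symbol \<Rightarrow> ('q^'m^'m) symbol list)"

lemma encode_letters:
  "encode_letter (first_letter l) = concat (map first_symbol (encode_letter l))"
  "encode_letter (second_letter l) = concat (map second_symbol (encode_letter l))"
  "encode_letter (linear_letter l) = concat (map linear_symbol (encode_letter l))"
  unfolding first_symbol_def second_symbol_def linear_symbol_def
  by (cases l; simp only: encode_letter.simps first_letter.simps second_letter.simps
      linear_letter.simps binary_shift list.map concat.simps translate.simps
      concat_map_translate_bits append.simps append_Nil2 o_apply)+

lemma encode_linear_word:
  "encode_word (map linear_letter u) = concat (map linear_symbol (encode_word u))"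
  by (induction u) (simp_all add: encode_letters)

lemma length_symbols:
  "length (first_symbol s) \<le> 4" "length (second_symbol s) \<le> 4" "length (linear_symbol s) \<le> 4"
  unfolding first_symbol_def second_symbol_def linear_symbol_def
  by (simp_all add: length_translate)

text \<open>The leading symbol of a letter is not a bit and needs a transfer of its own. Rewinding
  over the bits stops just behind it, hence the final move to the left; the letter can then be read
  again.\<close>

definition summand_machine where
  "summand_machine h = rewind_machine everything 2 \<then> copy_machine everything 2 3 (lift linear_symbol) \<then>
     transfer_machine 0 3 (lift h) \<then> copy_machine is_bit 0 3 (lift h) \<then>
     put_machine 3 (Inr EndSym) \<then> rewind_machine is_bit 0 \<then> move_machine 0 MLeft"

lemma runs_summand:
  assumes "3 < K" "F 0 = zipper ls (map Inl (encode_letter l) @ rs)"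
    "\<And>x r. rs = x # r \<Longrightarrow> \<not> is_bit x"
    "F 2 = zipper (rev (map Inl (encode_word u))) []" "F 3 = zipper ms []"
    "\<And>s. length (h s) \<le> 4" "encode_letter l' = concat (map h (encode_letter l))"
  shows "runs K (summand_machine h) F
    (F(3 := zipper (rev (inr_sum [map linear_letter u @ [l']]) @ ms) []))
    (10 * length (encode_word (u @ [l])) + 15)"
proof -
  obtain x b where x: "encode_letter l = x # map BitSym b" "\<And>c. x \<noteq> BitSym c"
    using encode_letter_cases by metis
  let ?U = "map Inl (encode_word u) :: ((('q^'m) \<times> ('q^'m^'m)) symbol + ('q^'m^'m) symbol) list"
  let ?B = "map Inl (map BitSym b) :: ((('q^'m) \<times> ('q^'m^'m)) symbol + ('q^'m^'m) symbol) list"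
  let ?x = "Inl x :: (('q^'m) \<times> ('q^'m^'m)) symbol + ('q^'m^'m) symbol"
  let ?F1 = "F(2 := zipper [] (?U @ []))"
  let ?a = "rev (concat (map (lift linear_symbol) ?U)) @ ms"
  let ?F2 = "?F1(2 := zipper (rev ?U @ []) [], 3 := zipper ?a [])"
  let ?b = "rev (lift h ?x) @ ?a"
  let ?F3 = "?F2(0 := zipper (?x # ls) (?B @ rs), 3 := zipper ?b [])"
  let ?c = "rev (concat (map (lift h) ?B)) @ ?b"
  let ?F4 = "?F3(0 := zipper (rev ?B @ ?x # ls) rs, 3 := zipper ?c [])"
  let ?F5 = "?F4(3 := zipper (Inr EndSym # ?c) [])"
  let ?F6 = "?F5(0 := zipper (?x # ls) (?B @ rs))"
  let ?F7 = "?F6(0 := left_of (?x # ls) (?B @ rs))"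
  have bits: "is_bit y" if "y \<in> set ?B" for y
    using that by auto
  have not_bit: "\<not> is_bit ?x"
    using x(2) by (cases x) auto
  have 1: "runs K (rewind_machine everything 2) F ?F1 (3 * length ?U + 3)"
    by (rule runs_rewind_all) (use assms in auto)
  have 2: "runs K (copy_machine everything 2 3 (lift linear_symbol)) ?F1 ?F2 (7 * length ?U + 1)"
    by (rule runs_copy) (use assms in \<open>auto intro!: length_lift length_symbols\<close>)
  have 3: "runs K (transfer_machine 0 3 (lift h)) ?F2 ?F3 5"
    by (rule runs_transfer) (use assms x in \<open>auto intro!: length_lift\<close>)
  have 4: "runs K (copy_machine is_bit 0 3 (lift h)) ?F3 ?F4 (7 * length ?B + 1)"
    by (rule runs_copy) (use assms bits in \<open>auto intro!: length_lift\<close>)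
  have 5: "runs K (put_machine 3 (Inr EndSym)) ?F4 ?F5 1"
    by (rule runs_put) (use assms in auto)
  have 6: "runs K (rewind_machine is_bit 0) ?F5 ?F6 (3 * length ?B + 3)"
    by (rule runs_rewind) (use assms bits not_bit in auto)
  have 7: "runs K (move_machine 0 MLeft) ?F6 ?F7 1"
    by (rule runs_left) (use assms in auto)
  have "map Inr (encode_letter l') = lift h ?x @ concat (map (lift h) ?B)"
    unfolding assms(7) x(1) concat_map_lift by (simp add: lift_def)
  then have c: "Inr EndSym # ?c = rev (inr_sum [map linear_letter u @ [l']]) @ ms"
    unfolding concat_map_lift encode_linear_word[symmetric] by simp
  have F: "?F7 = F(3 := zipper (rev (inr_sum [map linear_letter u @ [l']]) @ ms) [])"
    unfolding c using assms(2,4) x(1) by (auto simp: fun_eq_iff)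
  have "runs K (summand_machine h) F ?F7 (10 * length (encode_word (u @ [l])) + 15)"
    unfolding summand_machine_def
    by (rule runs_seq[OF 1 runs_seq[OF 2 runs_seq[OF 3 runs_seq[OF 4 runs_seq[OF 5
          runs_seq[OF 6 7 order_refl] order_refl] order_refl] order_refl] order_refl]])
      (simp add: x(1))
  then show ?thesis unfolding F .
qed

definition advance_machine ::
  "((('q^'m) \<times> ('q^'m^'m)) symbol + ('q^'m^'m) symbol) machine" where
  "advance_machine = transfer_machine 0 2 singleton \<then> copy_machine is_bit 0 2 singleton"

lemma runs_advance:
  assumes "3 < K" "F 0 = zipper ls (map Inl (encode_letter l) @ rs)"
    "\<And>x r. rs = x # r \<Longrightarrow> \<not> is_bit x"
    "F 2 = zipper (rev (map Inl (encode_word u))) []"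
  shows "runs K advance_machine F
    (F(0 := zipper (rev (map Inl (encode_letter l)) @ ls) rs,
       2 := zipper (rev (map Inl (encode_word (u @ [l])))) []))
    (7 * length (encode_word (u @ [l])) + 6)"
proof -
  obtain x b where x: "encode_letter l = x # map BitSym b" "\<And>c. x \<noteq> BitSym c"
    using encode_letter_cases by metis
  let ?U = "map Inl (encode_word u) :: ((('q^'m) \<times> ('q^'m^'m)) symbol + ('q^'m^'m) symbol) list"
  let ?B = "map Inl (map BitSym b) :: ((('q^'m) \<times> ('q^'m^'m)) symbol + ('q^'m^'m) symbol) list"
  let ?x = "Inl x :: (('q^'m) \<times> ('q^'m^'m)) symbol + ('q^'m^'m) symbol"
  let ?F1 = "F(0 := zipper (?x # ls) (?B @ rs), 2 := zipper (rev [?x] @ rev ?U) [])"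
  let ?F2 = "?F1(0 := zipper (rev ?B @ ?x # ls) rs, 2 := zipper (rev ?B @ rev [?x] @ rev ?U) [])"
  have 1: "runs K (transfer_machine 0 2 singleton) F ?F1 5"
    by (rule runs_transfer) (use assms x in auto)
  have 2: "runs K (copy_machine is_bit 0 2 singleton) ?F1 ?F2 (7 * length ?B + 1)"
    by (rule runs_copy_singleton) (use assms in auto)
  have F: "?F2 = F(0 := zipper (rev (map Inl (encode_letter l)) @ ls) rs,
       2 := zipper (rev (map Inl (encode_word (u @ [l])))) [])"
    by (auto simp: fun_eq_iff x(1))
  have "runs K advance_machine F ?F2 (7 * length (encode_word (u @ [l])) + 6)"
    unfolding advance_machine_def by (rule runs_seq[OF 1 2]) (simp add: x(1))
  then show ?thesis unfolding F .
qed

definition "vector_sum_machine = while_machine 0 (test everything)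
  (summand_machine first_symbol \<then> summand_machine second_symbol \<then> advance_machine)"

lemma runs_vector_sum:
  assumes "3 < K" "F 0 = zipper ls (map Inl (encode_word w))"
    "F 2 = zipper (rev (map Inl (encode_word u))) []" "F 3 = zipper ms []"
    "length (encode_word (u @ w)) \<le> n"
  shows "runs K vector_sum_machine F
    (F(0 := zipper (rev (map Inl (encode_word w)) @ ls) [],
       2 := zipper (rev (map Inl (encode_word (u @ w)))) [],
       3 := zipper (rev (inr_sum (vector_sum u w)) @ ms) []))
    (length w * (27 * n + 38) + 1)"
  using assms(2-)
proof (induction w arbitrary: F u ls ms)
  case Nil
  have "\<not> test everything (scan (F 0))" using Nil by simp
  from runs_while_False[of 0 K "test everything" F, OF _ this] assms(1)
  have "runs K vector_sum_machine F F 1"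
    by (simp add: vector_sum_machine_def)
  moreover have "F(0 := zipper (rev (map Inl (encode_word [])) @ ls) [],
       2 := zipper (rev (map Inl (encode_word (u @ [])))) [],
       3 := zipper (rev (inr_sum (vector_sum u [])) @ ms) []) = F"
    using Nil by (auto simp: fun_eq_iff)
  ultimately show ?case by (simp only: list.size mult_0 add_0)
next
  case (Cons l w)
  let ?body = "summand_machine first_symbol \<then> summand_machine second_symbol \<then> advance_machine"
  let ?r = "map Inl (encode_word w) :: ((('q^'m) \<times> ('q^'m^'m)) symbol + ('q^'m^'m) symbol) list"
  let ?F1 = "F(3 := zipper (rev (inr_sum [map linear_letter u @ [first_letter l]]) @ ms) [])"
  let ?s = "rev (inr_sum [map linear_letter u @ [second_letter l]]) @
      rev (inr_sum [map linear_letter u @ [first_letter l]]) @ ms"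
  let ?F2 = "?F1(3 := zipper ?s [])"
  let ?F3 = "?F2(0 := zipper (rev (map Inl (encode_letter l)) @ ls) ?r,
       2 := zipper (rev (map Inl (encode_word (u @ [l])))) [])"
  let ?F4 = "?F3(0 := zipper (rev ?r @ rev (map Inl (encode_letter l)) @ ls) [],
       2 := zipper (rev (map Inl (encode_word ((u @ [l]) @ w)))) [],
       3 := zipper (rev (inr_sum (vector_sum (u @ [l]) w)) @ ?s) [])"
  let ?t = "10 * length (encode_word (u @ [l])) + 15"
  have 1: "runs K (summand_machine first_symbol) F ?F1 ?t"
    by (rule runs_summand[where rs = ?r])
      (use assms(1) Cons.prems encode_letters length_symbols in
        \<open>auto simp: is_bit_hd_encode_word\<close>)
  have 2: "runs K (summand_machine second_symbol) ?F1 ?F2 ?t"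
    by (rule runs_summand[where rs = ?r])
      (use assms(1) Cons.prems encode_letters length_symbols in
        \<open>auto simp: is_bit_hd_encode_word\<close>)
  have 3: "runs K advance_machine ?F2 ?F3 (7 * length (encode_word (u @ [l])) + 6)"
    by (rule runs_advance)
      (use assms(1) Cons.prems in \<open>auto simp: is_bit_hd_encode_word\<close>)
  have len: "length (encode_word (u @ [l])) \<le> n" "length (encode_word ((u @ [l]) @ w)) \<le> n"
    using Cons.prems(4) by auto
  have 123: "runs K ?body F ?F3 (27 * n + 36)"
    by (rule runs_seq[OF 1 runs_seq[OF 2 3 order_refl]]) (use len in linarith)
  have 4: "runs K vector_sum_machine ?F3 ?F4 (length w * (27 * n + 38) + 1)"
    by (rule Cons.IH) (use len(2) in simp_all)
  have F: "?F4 = F(0 := zipper (rev (map Inl (encode_word (l # w))) @ ls) [],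
       2 := zipper (rev (map Inl (encode_word (u @ l # w)))) [],
       3 := zipper (rev (inr_sum (vector_sum u (l # w))) @ ms) [])"
    by (auto simp: fun_eq_iff)
  have test: "test everything (scan (F 0))"
    using Cons.prems(1) by (cases l) auto
  have "runs K vector_sum_machine F ?F4 (length (l # w) * (27 * n + 38) + 1)"
    unfolding vector_sum_machine_def
    by (rule runs_while_True[where F = F, OF _ test 123 4[unfolded vector_sum_machine_def]])
      (use assms(1) in auto)
  then show ?case unfolding F .
qed

definition "linear_machine = rewind_machine everything 2 \<then>
  copy_machine everything 2 4 (lift linear_symbol) \<then> put_machine 4 (Inr EndSym)"

lemma runs_linear:
  assumes "4 < K" "F 2 = zipper (rev (map Inl (encode_word w))) []" "F 4 = zipper [] []"
  shows "runs K linear_machine F (F(4 := zipper (rev (inr_sum [map linear_letter w])) []))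
    (10 * length (encode_word w) + 5)"
proof -
  let ?W = "map Inl (encode_word w) :: ((('q^'m) \<times> ('q^'m^'m)) symbol + ('q^'m^'m) symbol) list"
  let ?F1 = "F(2 := zipper [] (?W @ []))"
  let ?a = "rev (concat (map (lift linear_symbol) ?W)) @ []"
  let ?F2 = "?F1(2 := zipper (rev ?W @ []) [], 4 := zipper ?a [])"
  let ?F3 = "?F2(4 := zipper (Inr EndSym # ?a) [])"
  have 1: "runs K (rewind_machine everything 2) F ?F1 (3 * length ?W + 3)"
    by (rule runs_rewind_all) (use assms in auto)
  have 2: "runs K (copy_machine everything 2 4 (lift linear_symbol)) ?F1 ?F2 (7 * length ?W + 1)"
    by (rule runs_copy) (use assms in \<open>auto intro!: length_lift length_symbols\<close>)
  have 3: "runs K (put_machine 4 (Inr EndSym)) ?F2 ?F3 1"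
    by (rule runs_put) (use assms in auto)
  have F: "?F3 = F(4 := zipper (rev (inr_sum [map linear_letter w])) [])"
    unfolding concat_map_lift encode_linear_word[symmetric]
    using assms(2) by (auto simp: fun_eq_iff)
  have "runs K linear_machine F ?F3 (10 * length (encode_word w) + 5)"
    unfolding linear_machine_def
    by (rule runs_seq[OF 1 runs_seq[OF 2 3 order_refl]]) simp
  then show ?thesis unfolding F .
qed

section \<open>The complete machine and its running time\<close>

definition "reduction_machine p = vector_sum_machine \<then> linear_machine \<then> substitute_machine 5 p"

lemma well_formed_reduction: "well_formed (reduction_machine p)"
  unfolding reduction_machine_def vector_sum_machine_def linear_machine_def summand_machine_def
    advance_machine_def
  by (intro well_formed_intros well_formed_machines well_formed_substitute)

lemma length_concat_map_le:
  "(\<And>x. length (h x) \<le> c) \<Longrightarrow> length (concat (map h xs)) \<le> c * length xs"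
  by (induction xs) (auto intro: add_mono)

lemma length_linear_word: "length (encode_word (map linear_letter u)) \<le> 4 * length (encode_word u)"
  unfolding encode_linear_word by (rule length_concat_map_le[OF length_symbols(3)])

lemma length_le_encode_word: "length w \<le> length (encode_word w)"
proof (induction w)
  case (Cons l w)
  then show ?case by (cases l) auto
qed simp

text \<open>Each letter contributes two summands. Since a symbol becomes at most four, each has at
  most \<open>4 * n\<close> symbols and its \<open>EndSym\<close>.\<close>

lemma length_vector_sum:
  assumes "length (encode_word (u @ w)) \<le> n"
  shows "length (encode_sum (vector_sum u w)) \<le> length w * (8 * n + 2)"
  using assms
proof (induction w arbitrary: u)
  case (Cons l w)
  have "length (encode_letter (first_letter l)) \<le> 4 * length (encode_letter l)"
    "length (encode_letter (second_letter l)) \<le> 4 * length (encode_letter l)"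
    unfolding encode_letters by (rule length_concat_map_le[OF length_symbols(1)],
      rule length_concat_map_le[OF length_symbols(2)])
  moreover have "length (encode_sum (vector_sum (u @ [l]) w)) \<le> length w * (8 * n + 2)"
    by (rule Cons.IH) (use Cons.prems in simp)
  ultimately show ?case
    using length_linear_word[of u] Cons.prems by simp
qed simp

lemma runs_reduction:
  fixes w :: "(('q^'m) \<times> ('q^'m^'m)) letter list"
  defines "n \<equiv> length (encode_word w)"
  assumes "5 + sum_list (map length p) \<le> K" "F 0 = zipper [] (map Inl (encode_word w))"
    "\<forall>i>0. F i = zipper [] []"
  shows "\<exists>G. runs K (reduction_machine p) F G
      (n * (27 * n + 38) + 1 + (10 * n + 5 + substitute_time p (n * (8 * n + 2) + 4 * n + 2))) \<and>
    G 1 = zipper (rev (map Inr (encode_sum (substitute (parts w) p)))) []"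
proof -
  \<comment> \<open>The bounds for \<open>S\<close> and \<open>Q\<close> added up; the 2 covers the
    \<open>EndSym\<close> after \<open>Q\<close> and the demand \<open>2 \<le> L\<close> in
    \<open>sources\<close>.\<close>
  let ?L = "n * (8 * n + 2) + 4 * n + 2"
  let ?F1 = "F(0 := zipper (rev (map Inl (encode_word w)) @ []) [],
       2 := zipper (rev (map Inl (encode_word ([] @ w)))) [],
       3 := zipper (rev (inr_sum (vector_sum [] w)) @ []) [])"
  let ?F2 = "?F1(4 := zipper (rev (inr_sum [map linear_letter w])) [])"
  have n: "length w \<le> n" unfolding n_def by (rule length_le_encode_word)
  have 1: "runs K vector_sum_machine F ?F1 (length w * (27 * n + 38) + 1)"
    by (rule runs_vector_sum) (use assms in auto)
  have 2: "runs K linear_machine ?F1 ?F2 (10 * n + 5)"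
    unfolding n_def by (rule runs_linear) (use assms in auto)
  have "length (encode_sum (vector_sum [] w)) \<le> n * (8 * n + 2)"
    using length_vector_sum[of "[]" w n] mult_le_mono1[OF n, of "8 * n + 2"] by (simp add: n_def)
  moreover have "length (encode_sum [map linear_letter w]) \<le> 4 * n + 1"
    using length_linear_word[of w] by (simp add: n_def)
  ultimately have s: "sources ?F2 (parts w) ?L"
    unfolding sources_def source_def parts_def by auto
  have "\<exists>G. runs K (substitute_machine 5 p) ?F2 G (substitute_time p ?L) \<and>
      G 1 = zipper (rev (map Inr ([] @ encode_sum (substitute (parts w) p)))) []"
  proof (rule runs_substitute[of 5 p K ?F2 "parts w" ?L "[]"])
    show "sources ?F2 (parts w) ?L" by (rule s)
  qed (use assms in auto)
  then obtain G where G: "runs K (substitute_machine 5 p) ?F2 G (substitute_time p ?L)"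
    "G 1 = zipper (rev (map Inr ([] @ encode_sum (substitute (parts w) p)))) []"
    by blast
  have "runs K (reduction_machine p) F G
      (n * (27 * n + 38) + 1 + (10 * n + 5 + substitute_time p ?L))"
    unfolding reduction_machine_def
    by (rule runs_seq[OF 1 runs_seq[OF 2 G(1) order_refl]])
      (use mult_le_mono1[OF n, of "27 * n + 38"] in simp)
  then show ?thesis using G(2) by auto
qed

text \<open>\<open>p\<close> does not vary with the input, so the number of tapes and the nesting
  depth of the loops are constants.\<close>

lemma poly_time_computable_substitute:
  "poly_time_computable encode_word encode_sum D (\<lambda>w. substitute (parts w) p)"
proof -
  let ?T = "\<lambda>n. n * (27 * n + 38) + 1 + (10 * n + 5 + substitute_time p (n * (8 * n + 2) + 4 * n + 2))"
  have "poly_bounded ?T"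
    by (intro poly_bounded_intros poly_bounded_substitute_time)
  then obtain c d where T: "\<And>n. ?T n \<le> c * n ^ d + c"
    by (rule poly_boundedE) blast
  define K where "K = 5 + sum_list (map length p)"
  have "tm_computes_within K (reduction_machine p) (map Inl (encode_word w))
      (map Inr (encode_sum (substitute (parts w) p)))
      (c * length (encode_word w) ^ d + c)" for w
  proof -
    define F where "F i = zipper [] (if i = 0 then map Inl (encode_word w) else
       ([] :: ((('q^'m) \<times> ('q^'m^'m)) symbol + ('q^'m^'m) symbol) list))" for i :: nat
    obtain G where G: "runs K (reduction_machine p) F G (?T (length (encode_word w)))"
      "G 1 = zipper (rev (map Inr (encode_sum (substitute (parts w) p)))) []"
      using runs_reduction[of p K F w] by (auto simp: F_def K_def)
    obtain t where t: "t \<le> ?T (length (encode_word w))"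
      "(tm_step (reduction_machine p) ^^ t) (0, map F [0..<K]) =
        (length (reduction_machine p), map G [0..<K])"
      using G(1) unfolding runs_def by blast
    have "map F [0..<K] = (tape_content (map Inl (encode_word w)), 0) # replicate (K - 1) (\<lambda>_. None, 0)"
      by (rule nth_equalityI)
        (auto simp: F_def K_def zipper_def nth_Cons' tape_content_def fun_eq_iff)
    then have start: "start_config K (map Inl (encode_word w)) = (0, map F [0..<K])"
      by (simp add: start_config_def)
    have "fst (map G [0..<K] ! 1) = tape_content (map Inr (encode_sum (substitute (parts w) p)))"
      using G(2) by (simp add: K_def zipper_def)
    then show ?thesis
      unfolding tm_computes_within_def start
      using t le_trans[OF t(1) T] by blast
  qed
  moreover have "turing_machine K (reduction_machine p)"
    by (rule turing_machineI) (simp_all add: K_def well_formed_reduction)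
  ultimately show ?thesis
    unfolding poly_time_computable_def by blast
qed

lemma substitute_parts_words:
  assumes "p \<in> lists (words_over GL)" "w \<in> words_over (carrier Hol)"
  shows "substitute (parts w) p \<in> lists (words_over GL)"
proof -
  have s: "parts w i \<in> lists (words_over GL)" for i
    using vector_sum_words[of "[]" w] linear_letter_words[of w] assms(2) by (simp add: parts_def)
  have "product_polynomial (map (substitute_letter (parts w)) v) \<in> lists (words_over GL)"
    if "v \<in> words_over GL" for v
  proof (rule product_polynomial_words, intro ballI)
    fix r assume "r \<in> set (map (substitute_letter (parts w)) v)"
    then obtain l where l: "l \<in> set v" "r = substitute_letter (parts w) l" by auto
    then have "l \<in> Const ` GL \<union> range Var"
      using that by (auto simp: words_over_def lists_eq_set)
    then show "r \<in> lists (words_over GL)"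
      unfolding l(2) using s by (cases l) simp_all
  qed
  then show ?thesis
    using assms(1) by (auto simp: substitute_def lists_eq_set)
qed

end

theorem theorem3p8:
  fixes m q :: nat
  assumes "m = CARD('m::finite)" and "q = CARD('q::{field,finite})"
    and "(m, q) \<noteq> (1, 2)"
  shows "poly_time_reducible
           (PolSat (Hol :: (('q^'m) \<times> ('q^'m^'m)) monoid))
           (complement (RestrictedPolEquiv :: (('q^'m^'m) letter list list, ('q^'m^'m) symbol) problem))"
proof -
  interpret reduction "undefined :: 'm" "TYPE('q)"
    by unfold_locales (use assms in auto)
  obtain p0 where p0: "p0 \<in> lists (words_over GL)"
    "\<And>\<sigma> :: nat \<Rightarrow> 'q^'m^'m. polynomial_value \<sigma> p0 \<noteq> 0 \<longleftrightarrow>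
       \<sigma> 0 *v axis (undefined :: 'm) 1 = 0 \<and> \<sigma> 1 = mat 1"
    using indicator_polynomial by blast
  \<comment> \<open>\<open>p0\<close> may contain the empty word, and on the empty input
    \<open>Q\<close> is itself empty, so substitution could produce empty summands, which restricted
    polynomials exclude. A leading factor 1 prevents this without changing any value.\<close>
  define p where "p = map ((#) (Const (mat 1))) p0"
  have p: "p \<in> lists (words_over GL)"
    using p0(1) mat_1_in_GL by (auto simp: p_def lists_eq_set)
  have "polynomial_value \<sigma> p = polynomial_value \<sigma> p0" for \<sigma>
    unfolding p_def by (induction p0) simp_all
  then have indicator: "polynomial_value \<sigma> p \<noteq> 0 \<longleftrightarrow>
       \<sigma> 0 *v axis (undefined :: 'm) 1 = 0 \<and> \<sigma> 1 = mat 1" for \<sigma> :: "nat \<Rightarrow> 'q^'m^'m"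
    using p0(2) by metis
  let ?P = "\<lambda>w. substitute (parts w) p"
  have "[] \<notin> set (?P w)" for w
    by (auto simp: substitute_def p_def)
  then have "?P w \<in> restricted_polynomials" if "w \<in> words_over (carrier Hol)" for w
    using substitute_parts_words[OF p that]
    by (auto simp: restricted_polynomials_def lists_eq_set)
  then have "?P \<in> inputs (PolSat Hol) \<rightarrow> inputs (complement RestrictedPolEquiv)"
    by (auto simp: PolSat_def complement_def RestrictedPolEquiv_def)
  moreover have "poly_time_computable (encoding (PolSat Hol)) (encoding (complement RestrictedPolEquiv))
      (inputs (PolSat Hol)) ?P"
    using poly_time_computable_substitute
    by (simp add: PolSat_def complement_def RestrictedPolEquiv_def)
  ultimately show ?thesis
    unfolding poly_time_reducible_def using PolSat_iff[OF indicator] by blast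
qed

end
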